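(* Let $G$ be an acyclic digraph, let $S=\{s_1,\ldots,s_k\}$ be its set of sources (vertices of in-degree zero) and $T=\{t_1,\ldots,t_\ell\}$ its set of sinks (vertices of out-degree zero). Suppose that $S\cap T=\emptyset$, and every vertex not in $S\cup T$ has in-degree and out-degree both at least two. Then exactly one of the following holds: (i) there is a cross in $G$ relative to $(s_1,\ldots,s_k),(t_1,\ldots,t_\ell)$; (ii) $G$ can be drawn (without edge crossings) in a closed disc with $s_1,s_2,\ldots,s_k,t_\ell,t_{\ell-1},\ldots,t_1$ drawn in the boundary of the disc in this cyclic order.
   Context: Digraphs are finite, without loops or parallel edges. A digraph is acyclic if it has no directed cycle; a dipath is a directed path. Given a digraph $G$ and disjoint subsets $S=\{s_1,\ldots,s_k\}$ and $T=\{t_1,\ldots,t_\ell\}$ of $V(G)$, let $P$ be a dipath from $s_i\in S$ to $t_j\in T$ and $P'$ a dipath from $s_{i'}\in S$ to $t_{j'}\in T$. The pair $(P,P')$ is a cross relative to $(s_1,\ldots,s_k),(t_1,\ldots,t_\ell)$ if $P$ and $P'$ are vertex-disjoint and either $i<i'$ and $j>j'$, or $i>i'$ and $j<j'$. *)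

theory Defs
  imports "HOL-Analysis.Analysis" "Graph_Theory.Arc_Walk"
begin

definition sources :: "('a, 'b) pre_digraph \<Rightarrow> 'a set" where
  "sources G = {v \<in> verts G. in_degree G v = 0}"

definition sinks :: "('a, 'b) pre_digraph \<Rightarrow> 'a set" where
  "sinks G = {v \<in> verts G. out_degree G v = 0}"

definition acyclic_digraph :: "('a, 'b) pre_digraph \<Rightarrow> bool" where
  "acyclic_digraph G \<longleftrightarrow> (\<nexists>p. pre_digraph.cycle G p)"

definition vertex_disjoint ::
  "('a, 'b) pre_digraph \<Rightarrow> 'a \<times> 'b list \<Rightarrow> 'a \<times> 'b list \<Rightarrow> bool" where
  "vertex_disjoint G = (\<lambda>(u, p) (u', p').
     set (pre_digraph.awalk_verts G u p) \<inter> set (pre_digraph.awalk_verts G u' p') = {})"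

text \<open>The enumerations \<open>s\<^sub>1, \<dots>, s\<^sub>k\<close> and \<open>t\<^sub>1, \<dots>, t\<^sub>l\<close> are lists, indexed from 0. A dipath
  is an \<^const>\<open>pre_digraph.apath\<close>: a list of arcs together with its first vertex.\<close>

definition is_cross ::
  "('a, 'b) pre_digraph \<Rightarrow> 'a list \<Rightarrow> 'a list \<Rightarrow> 'b list \<Rightarrow> 'b list \<Rightarrow> bool" where
  "is_cross G ss ts p p' \<longleftrightarrow>
     (\<exists>i i' j j'. i < length ss \<and> i' < length ss \<and> j < length ts \<and> j' < length ts \<and>
        pre_digraph.apath G (ss ! i) p (ts ! j) \<and>
        pre_digraph.apath G (ss ! i') p' (ts ! j') \<and>
        vertex_disjoint G (ss ! i, p) (ss ! i', p') \<and>
        (i < i' \<and> j > j' \<or> i > i' \<and> j < j'))"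

text \<open>A drawing without edge crossings inside a set \<open>D\<close> of the plane: vertices are distinct points,
  arcs of the digraph are simple curves joining their ends (\<^const>\<open>arc\<close> is an injective path), a curve
  meets no vertex other than its two ends, and two curves meet only at common ends.\<close>

definition plane_drawing_in ::
  "complex set \<Rightarrow> ('a, 'b) pre_digraph \<Rightarrow> ('a \<Rightarrow> complex) \<Rightarrow> ('b \<Rightarrow> real \<Rightarrow> complex) \<Rightarrow> bool" where
  "plane_drawing_in D G pt cv \<longleftrightarrow>
     inj_on pt (verts G) \<and> pt ` verts G \<subseteq> D \<and>
     (\<forall>e\<in>arcs G. arc (cv e) \<and> path_image (cv e) \<subseteq> D \<and>
        pathstart (cv e) = pt (tail G e) \<and> pathfinish (cv e) = pt (head G e)) \<and>
     (\<forall>e\<in>arcs G. \<forall>v\<in>verts G. pt v \<in> path_image (cv e) \<longrightarrow> v \<in> {tail G e, head G e}) \<and>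
     (\<forall>e\<in>arcs G. \<forall>f\<in>arcs G. e \<noteq> f \<longrightarrow>
        path_image (cv e) \<inter> path_image (cv f)
          \<subseteq> pt ` ({tail G e, head G e} \<inter> {tail G f, head G f}))"

text \<open>The points lie on the unit circle and are met in the listed order during one single
  anticlockwise turn starting at the first of them. (The orientation is immaterial for
  the existence of a drawing: reflect the disc.)\<close>

definition circle_cyclic_order :: "complex list \<Rightarrow> bool" where
  "circle_cyclic_order zs \<longleftrightarrow>
     (\<exists>\<theta> :: nat \<Rightarrow> real.
        (\<forall>i < length zs. zs ! i = cis (\<theta> i)) \<and>
        strict_mono_on {..<length zs} \<theta> \<and>
        (\<forall>i < length zs. \<theta> i < \<theta> 0 + 2 * pi))"

definition drawable_in_disc :: "('a, 'b) pre_digraph \<Rightarrow> 'a list \<Rightarrow> bool" where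
  "drawable_in_disc G vs \<longleftrightarrow>
     (\<exists>pt cv. plane_drawing_in (cball 0 1) G pt cv \<and> circle_cyclic_order (map pt vs))"

end

theory Submission
  imports Defs
begin

text \<open>
  Crosses are incompatible with drawings: two interleaved chords of the disc serve as coordinate axes,
  along which the two paths are prolonged to the sides of a large box, where Fashoda's theorem applies.

  Without a cross, draw the digraph by induction on the number of arcs, in a strip with the sources on
  the bottom line and the sinks on the top line. If there is no inner vertex, straight segments
  do. Otherwise let \<open>v\<close> be an inner vertex all of whose in-neighbours are sources, and let \<open>a\<close> and \<open>c\<close> be
  the first and the last of them. A source between \<open>a\<close> and \<open>c\<close> with an out-neighbour \<open>x \<noteq> v\<close> would
  give a cross: as out-degrees are at least two, there are disjoint dipaths from \<open>x\<close> and \<open>v\<close> to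
  sinks, and the second can be started at \<open>a\<close> or at \<open>c\<close>, whichever crosses. So all arcs into \<open>v\<close> can be
  deleted and \<open>v\<close> can replace the sources between \<open>a\<close> and \<open>c\<close>. This creates no cross, since a dipath
  from \<open>v\<close> can be started at \<open>a\<close> or \<open>c\<close> in the old digraph. In the drawing of the new digraph push \<open>v\<close> up
  from the bottom line and draw the deleted arcs below it.
\<close>

section \<open>Crosses and the reduction step\<close>

text \<open>The recursive form is easy to evaluate on lists such as
  \<open>A @ a # M @ c # C\<close>. The form with indices, which matches \<open>is_cross\<close>, is
  \<open>before_iff_nth\<close>.\<close>

primrec before :: "'a list \<Rightarrow> 'a \<Rightarrow> 'a \<Rightarrow> bool" where
  "before [] a b \<longleftrightarrow> False"
| "before (x # xs) a b \<longleftrightarrow> a = x \<and> b \<in> set xs \<or> before xs a b"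

lemma before_append:
  "before (xs @ ys) a b \<longleftrightarrow> before xs a b \<or> before ys a b \<or> a \<in> set xs \<and> b \<in> set ys"
  by (induction xs) auto

lemma before_in_set: "before xs a b \<Longrightarrow> a \<in> set xs \<and> b \<in> set xs"
  by (induction xs) auto

lemma before_total: "a \<in> set xs \<Longrightarrow> b \<in> set xs \<Longrightarrow> a \<noteq> b \<Longrightarrow> before xs a b \<or> before xs b a"
  by (induction xs) auto

lemma before_iff_nth: "before xs a b \<longleftrightarrow> (\<exists>i j. i < j \<and> j < length xs \<and> xs ! i = a \<and> xs ! j = b)"
proof (induction xs)
  case (Cons x xs)
  have "(\<exists>i j. i < j \<and> j < length (x # xs) \<and> (x # xs) ! i = a \<and> (x # xs) ! j = b) \<longleftrightarrow>
    (x = a \<and> (\<exists>j<length xs. xs ! j = b)) \<or> (\<exists>i j. i < j \<and> j < length xs \<and> xs ! i = a \<and> xs ! j = b)"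
    (is "?L \<longleftrightarrow> ?R")
  proof
    assume ?L
    then obtain i j where "i < j" "j < length (x # xs)" "(x # xs) ! i = a" "(x # xs) ! j = b" by blast
    then show ?R by (cases i; cases j) auto
  next
    assume ?R
    then show ?L
    proof (elim disjE conjE exE)
      fix j assume "x = a" "j < length xs" "xs ! j = b"
      then show ?L by (intro exI[of _ 0] exI[of _ "Suc j"]) auto
    next
      fix i j assume "i < j" "j < length xs" "xs ! i = a" "xs ! j = b"
      then show ?L by (intro exI[of _ "Suc i"] exI[of _ "Suc j"]) auto
    qed
  qed
  with Cons show ?case by (auto simp: in_set_conv_nth)
qed simp

text \<open>The set argument collects the visited vertices, which is all that disjointness needs.
  Repeated vertices are not excluded here; acyclicity rules them out.\<close>

inductive dwalk :: "('a \<times> 'a) set \<Rightarrow> 'a \<Rightarrow> 'a set \<Rightarrow> 'a \<Rightarrow> bool" for E where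
  dwalk_refl: "dwalk E x {x} x"
| dwalk_step: "(x, y) \<in> E \<Longrightarrow> dwalk E y P z \<Longrightarrow> dwalk E x (insert x P) z"

lemma dwalk_mono: "dwalk E x P z \<Longrightarrow> E \<subseteq> F \<Longrightarrow> dwalk F x P z"
  by (induction rule: dwalk.induct) (auto intro: dwalk.intros)

lemma dwalk_reachable: "dwalk E x P z \<Longrightarrow> w \<in> P \<Longrightarrow> (x, w) \<in> E\<^sup>*"
  by (induction rule: dwalk.induct) (auto intro: converse_rtrancl_into_rtrancl)

lemma dwalk_ends: "dwalk E x P z \<Longrightarrow> x \<in> P \<and> z \<in> P"
  by (induction rule: dwalk.induct) auto

lemma dwalk_subset: "dwalk E x P z \<Longrightarrow> P \<subseteq> insert x (Range E)"
  by (induction rule: dwalk.induct) auto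

text \<open>One of the two cases of \<open>is_cross\<close> is enough: exchanging the two walks
  turns it into the other.\<close>

definition crossed :: "('a \<times> 'a) set \<Rightarrow> 'a list \<Rightarrow> 'a list \<Rightarrow> bool" where
  "crossed E ss ts \<longleftrightarrow> (\<exists>s s' t t' P P'. before ss s s' \<and> before ts t' t \<and>
     dwalk E s P t \<and> dwalk E s' P' t' \<and> P \<inter> P' = {})"

text \<open>The invariant of the induction. \<open>ss\<close> may contain vertices without arcs,
  since the reduction can take away the last arc of a source. Degree at least two is expressed by
  two distinct neighbours.\<close>

definition network :: "('a \<times> 'a) set \<Rightarrow> 'a list \<Rightarrow> 'a list \<Rightarrow> bool" where
  "network E ss ts \<longleftrightarrow> finite E \<and> acyclic E \<and> distinct ss \<and> distinct ts \<and>
     set ss \<inter> set ts = {} \<and> set ss \<inter> Range E = {} \<and> set ts \<inter> Domain E = {} \<and>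
     (\<forall>v \<in> Field E - set ss - set ts.
        (\<exists>x y. x \<noteq> y \<and> (x, v) \<in> E \<and> (y, v) \<in> E) \<and>
        (\<exists>x y. x \<noteq> y \<and> (v, x) \<in> E \<and> (v, y) \<in> E))"

text \<open>Always advance an end that the other one cannot reach; the vertex it leaves is then off both
  continuations.\<close>

lemma two_linkage:
  assumes "network E ss ts"
  shows "x \<noteq> y \<Longrightarrow> x \<in> Range E \<Longrightarrow> y \<in> Range E \<Longrightarrow>
    \<exists>t t' P P'. t \<in> set ts \<and> t' \<in> set ts \<and> dwalk E x P t \<and> dwalk E y P' t' \<and> P \<inter> P' = {}"
proof (induction "card (E\<^sup>* `` {x}) + card (E\<^sup>* `` {y})" arbitrary: x y rule: less_induct)
  case less
  have fin: "finite E" and acyc: "acyclic E" and disj: "set ss \<inter> Range E = {}"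
    and snk: "set ts \<inter> Domain E = {}"
    and inner: "\<And>v. v \<in> Field E \<Longrightarrow> v \<notin> set ss \<Longrightarrow> v \<notin> set ts \<Longrightarrow>
        \<exists>x y. x \<noteq> y \<and> (v, x) \<in> E \<and> (v, y) \<in> E"
    using assms by (auto simp: network_def)
  have finr: "finite (E\<^sup>* `` {a})" for a
    by (rule finite_subset[of _ "insert a (Range E)"])
      (use fin in \<open>auto simp: finite_Range Range_iff elim: rtranclE\<close>)
  \<comment> \<open>Advances the end \<open>u\<close>. The last premise lets the same fact serve for
    \<open>x\<close>, \<open>y\<close> in either order under the induction hypothesis.\<close>
  have step: "\<exists>t t' P P'. t \<in> set ts \<and> t' \<in> set ts \<and> dwalk E u P t \<and> dwalk E w P' t' \<and> P \<inter> P' = {}"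
    if "u \<noteq> w" "u \<in> Range E" "w \<in> Range E" "u \<notin> set ts" "(w, u) \<notin> E\<^sup>*"
      "card (E\<^sup>* `` {u}) + card (E\<^sup>* `` {w}) = card (E\<^sup>* `` {x}) + card (E\<^sup>* `` {y})" for u w
  proof -
    have "\<exists>x y. x \<noteq> y \<and> (u, x) \<in> E \<and> (u, y) \<in> E"
      by (rule inner) (use that disj in \<open>auto simp: Field_def\<close>)
    \<comment> \<open>Of two out-neighbours at least one is not \<open>w\<close>, so the two ends
      stay distinct.\<close>
    then obtain u' where u': "(u, u') \<in> E" "u' \<noteq> w" by metis
    have nr: "(u', u) \<notin> E\<^sup>*"
      using acyc u'(1) by (meson acyclic_def rtrancl_into_trancl2)
    have "E\<^sup>* `` {u'} \<subset> E\<^sup>* `` {u}"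
      using u'(1) nr by (auto intro: converse_rtrancl_into_rtrancl)
    then have "card (E\<^sup>* `` {u'}) < card (E\<^sup>* `` {u})"
      using finr by (simp add: psubset_card_mono)
    then have "card (E\<^sup>* `` {u'}) + card (E\<^sup>* `` {w}) < card (E\<^sup>* `` {x}) + card (E\<^sup>* `` {y})"
      using that(6) by linarith
    from less.hyps[OF this u'(2) _ that(3)] u'(1)
    obtain t t' P P' where *: "t \<in> set ts" "t' \<in> set ts" "dwalk E u' P t" "dwalk E w P' t'" "P \<inter> P' = {}"
      by blast
    have "dwalk E u (insert u P) t" using dwalk_step u'(1) *(3) by metis
    moreover have "u \<notin> P'" using dwalk_reachable *(4) that(5) by metis
    ultimately show ?thesis using * by blast
  qed
  \<comment> \<open>Only the first three cases can occur: the fourth gives a directed cycle, the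
    last two an arc leaving a vertex of \<open>ts\<close>.\<close>
  consider "x \<in> set ts" "y \<in> set ts" | "x \<notin> set ts" "(y, x) \<notin> E\<^sup>*" | "y \<notin> set ts" "(x, y) \<notin> E\<^sup>*"
    | "(x, y) \<in> E\<^sup>*" "(y, x) \<in> E\<^sup>*" | "x \<in> set ts" "(x, y) \<in> E\<^sup>*" | "y \<in> set ts" "(y, x) \<in> E\<^sup>*"
    by blast
  then show ?case
  proof cases
    case 1
    then show ?thesis using less.prems(1) dwalk_refl[of E x] dwalk_refl[of E y] by blast
  next
    case 2
    then show ?thesis using step[of x y] less.prems by blast
  next
    case 3
    then obtain t t' P P' where "t \<in> set ts" "t' \<in> set ts" "dwalk E y P t" "dwalk E x P' t'" "P \<inter> P' = {}"
      using step[of y x] less.prems by (auto simp: add.commute)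
    then show ?thesis by blast
  next
    case 4
    then have "(x, x) \<in> E\<^sup>+"
      using less.prems(1) by (meson rtranclD trancl_rtrancl_trancl)
    then show ?thesis using acyc by (auto simp: acyclic_def)
  next
    case 5
    then have "x \<in> Domain E" using less.prems(1) by (metis Domain.DomainI converse_rtranclE)
    then show ?thesis using 5 snk by auto
  next
    case 6
    then have "y \<in> Domain E" using less.prems(1) by (metis Domain.DomainI converse_rtranclE)
    then show ?thesis using 6 snk by auto
  qed
qed

text \<open>An inner vertex that is minimal for the well-founded relation \<open>E\<close> has no
  inner in-neighbour, and no arc starts in \<open>ts\<close>.\<close>

lemma exists_first_internal:
  assumes net: "network E ss ts" and ne: "\<not> E \<subseteq> set ss \<times> set ts"
  obtains v where "v \<in> Field E" "v \<notin> set ss" "v \<notin> set ts" "E\<inverse> `` {v} \<subseteq> set ss"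
proof -
  have wf: "wf E" using net by (simp add: network_def finite_acyclic_wf)
  let ?I = "Field E - set ss - set ts"
  obtain a b where ab: "(a, b) \<in> E" "a \<notin> set ss \<or> b \<notin> set ts" using ne by auto
  then have "a \<in> ?I \<or> b \<in> ?I" using net by (auto simp: network_def Field_def)
  then obtain v where v: "v \<in> ?I" "\<And>u. (u, v) \<in> E \<Longrightarrow> u \<notin> ?I"
    using wfE_min[OF wf] by metis
  have "E\<inverse> `` {v} \<subseteq> set ss"
  proof
    fix u assume "u \<in> E\<inverse> `` {v}"
    then have "(u, v) \<in> E" by auto
    moreover from this have "u \<in> Field E" "u \<notin> set ts" using net by (auto simp: network_def Field_def)
    ultimately show "u \<in> set ss" using v(2) by blast
  qed
  then show ?thesis using v that by blast
qed

text \<open>Supplies the outermost in-neighbours \<open>a\<close> and \<open>c\<close> of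
  \<open>v\<close>. Two distinct witnesses make the first and the last one occupy different
  positions.\<close>

lemma outer_split:
  assumes "x \<noteq> y" "x \<in> set xs" "y \<in> set xs" "Q x" "Q y"
  obtains A a M c C where "xs = A @ a # M @ c # C" "Q a" "Q c" "\<forall>z \<in> set A \<union> set C. \<not> Q z"
proof -
  obtain A a R where 1: "xs = A @ a # R" "Q a" "\<forall>z \<in> set A. \<not> Q z"
    using split_list_first_prop[of xs Q] assms by metis
  have "\<exists>z \<in> set R. Q z" using assms 1 by auto
  then obtain M c C where 2: "R = M @ c # C" "Q c" "\<forall>z \<in> set C. \<not> Q z"
    using split_list_last_prop[of R Q] by metis
  show ?thesis using that[of A a M c C] 1 2 by auto
qed

text \<open>Otherwise \<open>two_linkage\<close> leads from \<open>x\<close> and \<open>v\<close> to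
  different sinks, and the walk through \<open>v\<close> can be started on either side of
  \<open>m\<close>.\<close>

lemma sources_between:
  assumes net: "network E ss ts" and nc: "\<not> crossed E ss ts"
    and ss: "ss = A @ a # M @ c # C" and av: "(a, v) \<in> E" and cv: "(c, v) \<in> E"
    and m: "m \<in> set M" "(m, x) \<in> E"
  shows "x = v"
proof (rule ccontr)
  assume "x \<noteq> v"
  then obtain t t' P P' where *: "t \<in> set ts" "t' \<in> set ts" "dwalk E x P t" "dwalk E v P' t'" "P \<inter> P' = {}"
    using two_linkage[OF net, of x v] m av by blast
  have src: "set ss \<inter> Range E = {}" and dist: "distinct ss" using net by (auto simp: network_def)
  have sub: "P \<subseteq> Range E" "P' \<subseteq> Range E"
    using dwalk_subset[OF *(3)] dwalk_subset[OF *(4)] m(2) av by auto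
  \<comment> \<open>All vertices of both walks have in-arcs, so no source lies on them, and
    prolonging them back to different sources keeps them disjoint.\<close>
  have "m \<notin> P'" "a \<notin> P" "c \<notin> P" "m \<noteq> a" "m \<noteq> c" using sub src ss m dist by auto
  then have dj: "insert m P \<inter> insert a P' = {}" "insert m P \<inter> insert c P' = {}" using * by auto
  have w: "dwalk E m (insert m P) t" "dwalk E a (insert a P') t'" "dwalk E c (insert c P') t'"
    using * m av cv by (auto intro: dwalk_step)
  have "t \<noteq> t'" using * dwalk_ends by (metis disjoint_iff)
  then consider "before ts t' t" | "before ts t t'" using before_total *(1,2) by metis
  then have "crossed E ss ts"
  proof cases
    case 1
    moreover have "before ss m c" using ss m by (simp add: before_append)
    ultimately show ?thesis unfolding crossed_def using w dj by blast
  next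
    case 2
    moreover have "before ss a m" using ss m by (simp add: before_append)
    ultimately show ?thesis unfolding crossed_def using w dj by (metis Int_commute)
  qed
  then show False using nc by simp
qed

text \<open>\<open>a\<close> and \<open>c\<close> remain as sources on both sides of
  \<open>v\<close>, since they may have further out-arcs; the sources between them have at most the
  arc into \<open>v\<close> and disappear. A cross of the smaller network lifts because a walk from
  \<open>v\<close> can be prolonged backwards.\<close>

lemma reduction:
  assumes net: "network E ss ts" and nc: "\<not> crossed E ss ts"
    and v: "v \<in> Field E" "v \<notin> set ss" "v \<notin> set ts" "E\<inverse> `` {v} \<subseteq> set ss"
  obtains A a M c C where "ss = A @ a # M @ c # C"
    and "(a, v) \<in> E" "(c, v) \<in> E" "E\<inverse> `` {v} \<subseteq> {a, c} \<union> set M" "E `` set M \<subseteq> {v}"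
    and "network (E - UNIV \<times> {v}) (A @ a # v # c # C) ts"
    and "\<not> crossed (E - UNIV \<times> {v}) (A @ a # v # c # C) ts"
proof -
  have inner: "\<And>v. v \<in> Field E \<Longrightarrow> v \<notin> set ss \<Longrightarrow> v \<notin> set ts \<Longrightarrow>
        (\<exists>x y. x \<noteq> y \<and> (x, v) \<in> E \<and> (y, v) \<in> E) \<and> (\<exists>x y. x \<noteq> y \<and> (v, x) \<in> E \<and> (v, y) \<in> E)"
    using net by (auto simp: network_def)
  obtain x y where xy: "x \<noteq> y" "(x, v) \<in> E" "(y, v) \<in> E" using inner[of v] v by blast
  obtain A a M c C where ss: "ss = A @ a # M @ c # C" and av: "(a, v) \<in> E" and cv: "(c, v) \<in> E"
    and AC: "\<forall>z \<in> set A \<union> set C. (z, v) \<notin> E"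
    using outer_split[of x y ss "\<lambda>z. (z, v) \<in> E"] xy v(4) by blast
  let ?E = "E - UNIV \<times> {v}" and ?ss = "A @ a # v # c # C"
  have inv: "E\<inverse> `` {v} \<subseteq> {a, c} \<union> set M" using v(4) ss AC by auto
  have M: "E `` set M \<subseteq> {v}" using sources_between[OF net nc ss av cv] by auto
  have n: "finite E" "acyclic E" "distinct ss" "distinct ts" "set ss \<inter> set ts = {}"
    "set ss \<inter> Range E = {}" "set ts \<inter> Domain E = {}"
    using net by (auto simp: network_def)
  have net': "network ?E ?ss ts"
    unfolding network_def
  proof (intro conjI ballI)
    show "acyclic ?E" using n(2) by (rule acyclic_subset) auto
    fix w assume w: "w \<in> Field ?E - set ?ss - set ts"
    have "w \<notin> set M" using w M n(6) ss by (auto simp: Field_def)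
    then have w': "w \<in> Field E" "w \<notin> set ss" "w \<notin> set ts" "w \<noteq> v"
      using w ss by (auto simp: Field_def)
    \<comment> \<open>Every arc into \<open>v\<close> starts at a source, so an inner vertex other
      than \<open>v\<close> keeps all its arcs.\<close>
    have "(w, v) \<notin> E" using w'(2) v(4) by auto
    then show "\<exists>x y. x \<noteq> y \<and> (x, w) \<in> ?E \<and> (y, w) \<in> ?E" "\<exists>x y. x \<noteq> y \<and> (w, x) \<in> ?E \<and> (w, y) \<in> ?E"
      using inner[OF w'(1-3)] w'(4) by auto
  qed (use n ss v in auto)
  have "\<not> crossed ?E ?ss ts"
  proof
    assume "crossed ?E ?ss ts"
    then obtain s s' t t' P P' where *: "before ?ss s s'" "before ts t' t" "dwalk ?E s P t"
        "dwalk ?E s' P' t'" "P \<inter> P' = {}"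
      unfolding crossed_def by blast
    have w: "dwalk E s P t" "dwalk E s' P' t'" using * by (auto intro: dwalk_mono)
    have sub: "P \<subseteq> insert s (Range E)" "P' \<subseteq> insert s' (Range E)"
      using w dwalk_subset by metis+
    have ac: "a \<notin> Range E" "c \<notin> Range E" using n(6) ss by auto
    have dist: "distinct ?ss" using n(3) ss v(2) by auto
    consider "s = v" | "s' = v" | "s \<noteq> v" "s' \<noteq> v" by blast
    then have "crossed E ss ts"
    proof cases
      case 1
      \<comment> \<open>\<open>s'\<close> comes after \<open>v\<close> and may be \<open>c\<close>
        itself, so the walk from \<open>v\<close> is prolonged back to \<open>a\<close>. The next
        case is the mirror image.\<close>
      then have s': "s' \<in> set (c # C)" using *(1) dist before_in_set[of A v s'] before_in_set[of C v s']
        by (auto simp: before_append)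
      have "before ss a s'" using s' ss by (auto simp: before_append)
      moreover have "dwalk E a (insert a P) t" using av w 1 by (auto intro: dwalk_step)
      moreover have "insert a P \<inter> P' = {}" using *(5) sub ac s' dist by auto
      ultimately show ?thesis unfolding crossed_def using * w by blast
    next
      case 2
      then have s': "s \<in> set (A @ [a])" using *(1) dist before_in_set[of A s v] before_in_set[of C s v]
        by (auto simp: before_append)
      have "before ss s c" using s' ss by (auto simp: before_append)
      moreover have "dwalk E c (insert c P') t'" using cv w 2 by (auto intro: dwalk_step)
      moreover have "P \<inter> insert c P' = {}" using *(5) sub ac s' dist by auto
      ultimately show ?thesis unfolding crossed_def using * w by blast
    next
      case 3
      then have "before ss s s'" using *(1) ss by (auto simp: before_append)
      then show ?thesis unfolding crossed_def using * w by blast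
    qed
    then show False using nc by simp
  qed
  then show ?thesis using that[OF ss av cv inv M net'] by blast
qed

section \<open>Drawings in a strip\<close>

lemma plane_drawing_inD:
  assumes "plane_drawing_in D G pt cv"
  shows "inj_on pt (verts G)"
    and "v \<in> verts G \<Longrightarrow> pt v \<in> D"
    and "e \<in> arcs G \<Longrightarrow> arc (cv e) \<and> path_image (cv e) \<subseteq> D \<and>
        pathstart (cv e) = pt (tail G e) \<and> pathfinish (cv e) = pt (head G e)"
    and "e \<in> arcs G \<Longrightarrow> v \<in> verts G \<Longrightarrow> pt v \<in> path_image (cv e) \<Longrightarrow> v \<in> {tail G e, head G e}"
    and "e \<in> arcs G \<Longrightarrow> f \<in> arcs G \<Longrightarrow> e \<noteq> f \<Longrightarrow> path_image (cv e) \<inter> path_image (cv f)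
        \<subseteq> pt ` ({tail G e, head G e} \<inter> {tail G f, head G f})"
  using assms by (simp_all add: plane_drawing_in_def image_subset_iff)

text \<open>Applied twice: to the map that lifts the bottom line of the strip, and to the map from
  the strip to the disc.\<close>

lemma plane_drawing_in_image:
  assumes "plane_drawing_in D G pt cv" and cont: "continuous_on D f" and inj: "inj_on f D"
    and sub: "f ` D \<subseteq> D'" and wf: "\<And>e. e \<in> arcs G \<Longrightarrow> tail G e \<in> verts G \<and> head G e \<in> verts G"
  shows "plane_drawing_in D' G (f \<circ> pt) (\<lambda>e. f \<circ> cv e)"
proof -
  note d = plane_drawing_inD[OF assms(1)]
  have d2: "pt ` verts G \<subseteq> D" using d(2) by blast
  show ?thesis
    unfolding plane_drawing_in_def
  proof (intro conjI ballI impI)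
    show "inj_on (f \<circ> pt) (verts G)"
      by (rule comp_inj_on[OF d(1) inj_on_subset[OF inj d2]])
    show "(f \<circ> pt) ` verts G \<subseteq> D'" using d2 sub by (auto simp: image_subset_iff)
  next
    fix e assume e: "e \<in> arcs G"
    note de = d(3)[OF e]
    have "path (f \<circ> cv e)"
      using de by (intro path_continuous_image continuous_on_subset[OF cont] arc_imp_path) auto
    moreover have "inj_on (f \<circ> cv e) {0..1}"
      using de by (intro comp_inj_on inj_on_subset[OF inj]) (auto simp: arc_def path_image_def)
    ultimately show "arc (f \<circ> cv e)" by (simp add: arc_def)
    show "path_image (f \<circ> cv e) \<subseteq> D'" using de sub by (auto simp: path_image_compose)
    show "pathstart (f \<circ> cv e) = (f \<circ> pt) (tail G e)" "pathfinish (f \<circ> cv e) = (f \<circ> pt) (head G e)"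
      using de by (auto simp: pathstart_compose pathfinish_compose)
    fix v assume v: "v \<in> verts G" "(f \<circ> pt) v \<in> path_image (f \<circ> cv e)"
    then obtain z where "z \<in> path_image (cv e)" "f (pt v) = f z" by (auto simp: path_image_compose)
    then have "pt v \<in> path_image (cv e)" using inj_onD[OF inj, of "pt v" z] d2 de v(1) by auto
    then show "v \<in> {tail G e, head G e}" using d(4) e v by blast
  next
    fix e e' assume e: "e \<in> arcs G" "e' \<in> arcs G" "e \<noteq> e'"
    show "path_image (f \<circ> cv e) \<inter> path_image (f \<circ> cv e')
        \<subseteq> (f \<circ> pt) ` ({tail G e, head G e} \<inter> {tail G e', head G e'})"
    proof
      fix w assume "w \<in> path_image (f \<circ> cv e) \<inter> path_image (f \<circ> cv e')"
      then obtain z z' where z: "z \<in> path_image (cv e)" "z' \<in> path_image (cv e')" "w = f z" "w = f z'"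
        by (auto simp: path_image_compose)
      have "z = z'" using z inj_onD[OF inj, of z z'] d(3)[OF e(1)] d(3)[OF e(2)] by auto
      then have "z \<in> pt ` ({tail G e, head G e} \<inter> {tail G e', head G e'})" using d(5)[OF e] z by blast
      then show "w \<in> (f \<circ> pt) ` ({tail G e, head G e} \<inter> {tail G e', head G e'})" using z by auto
    qed
  qed
qed

text \<open>The vertical sides are left out, because \<open>strip_to_disc\<close> would collapse
  each of them to a point.\<close>

definition strip :: "complex set" where
  "strip = {z. - 1 < Re z \<and> Re z < 1 \<and> 0 \<le> Im z \<and> Im z \<le> 1}"

text \<open>Each pair serves as its own arc. \<open>Field E\<close> alone would miss sources without
  arcs.\<close>

abbreviation network_graph :: "('a \<times> 'a) set \<Rightarrow> 'a list \<Rightarrow> 'a list \<Rightarrow> ('a, 'a \<times> 'a) pre_digraph" where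
  "network_graph E ss ts \<equiv>
     \<lparr>verts = Field E \<union> set ss \<union> set ts, arcs = E, tail = fst, head = snd\<rparr>"

text \<open>The last condition keeps the curves off the bottom line, except at the sources: the step that
  turns a source into an inner vertex draws its new arcs right below the lifted bottom line.\<close>

definition strip_drawing :: "('a \<times> 'a) set \<Rightarrow> 'a list \<Rightarrow> 'a list \<Rightarrow>
    ('a \<Rightarrow> complex) \<Rightarrow> ('a \<times> 'a \<Rightarrow> real \<Rightarrow> complex) \<Rightarrow> bool" where
  "strip_drawing E ss ts pt cv \<longleftrightarrow>
     plane_drawing_in strip (network_graph E ss ts) pt cv \<and>
     sorted_wrt (\<lambda>x y. Re (pt x) < Re (pt y)) ss \<and> sorted_wrt (\<lambda>x y. Re (pt x) < Re (pt y)) ts \<and>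
     (\<forall>s \<in> set ss. Im (pt s) = 0) \<and> (\<forall>t \<in> set ts. Im (pt t) = 1) \<and>
     (\<forall>w \<in> Field E \<union> set ss \<union> set ts. Im (pt w) = 0 \<longrightarrow> w \<in> set ss) \<and>
     (\<forall>e \<in> E. \<forall>z \<in> path_image (cv e). Im z = 0 \<longrightarrow> z \<in> pt ` set ss)"

section \<open>Straight drawings of networks without inner vertices\<close>

lemma spread:
  assumes "distinct xs" "l < (r :: real)"
  obtains g where "sorted_wrt (\<lambda>x y. g x < g y) xs" "\<forall>x \<in> set xs. l < g x \<and> g x < r"
proof -
  have "\<exists>g. sorted_wrt (\<lambda>x y. g x < g y) xs \<and> (\<forall>x \<in> set xs. l < g x \<and> g x < r)"
    using assms
  proof (induction xs arbitrary: l)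
    case (Cons x xs)
    let ?c = "(l + r) / 2"
    have c: "l < ?c" "?c < r" "distinct xs" using Cons.prems by auto
    obtain g where g: "sorted_wrt (\<lambda>x y. g x < g y) xs" "\<forall>y \<in> set xs. ?c < g y \<and> g y < r"
      using Cons.IH[OF c(3,2)] by blast
    have "sorted_wrt (\<lambda>u y. (g(x := ?c)) u < (g(x := ?c)) y) xs"
      by (rule sorted_wrt_mono_rel[OF _ g(1)]) (use Cons.prems in auto)
    then have "sorted_wrt (\<lambda>u y. (g(x := ?c)) u < (g(x := ?c)) y) (x # xs)"
      using g(2) Cons.prems by auto
    moreover have "\<forall>y \<in> set (x # xs). l < (g(x := ?c)) y \<and> (g(x := ?c)) y < r"
      using g(2) c by auto
    ultimately show ?case by blast
  qed auto
  then show ?thesis using that by blast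
qed

lemma sorted_wrt_before: "sorted_wrt P xs \<Longrightarrow> before xs a b \<Longrightarrow> P a b"
  by (induction xs) auto

lemma mem_segment_complex:
  "z \<in> closed_segment p q \<longleftrightarrow>
    (\<exists>u. 0 \<le> u \<and> u \<le> 1 \<and> Re z = Re p + u * (Re q - Re p) \<and> Im z = Im p + u * (Im q - Im p))"
  by (auto simp: in_segment complex_eq_iff algebra_simps)

lemma convex_strip: "convex strip"
proof -
  have "strip = {z. Re z > - 1} \<inter> {z. Re z < 1} \<inter> {z. Im z \<ge> 0} \<inter> {z. Im z \<le> 1}"
    by (auto simp: strip_def)
  moreover have "convex ({z. Re z > - 1} \<inter> {z. Re z < 1} \<inter> {z. Im z \<ge> 0} \<inter> {z. Im z \<le> 1})"
    by (intro convex_Int convex_halfspace_Re_gt convex_halfspace_Re_lt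
        convex_halfspace_Im_ge convex_halfspace_Im_le)
  ultimately show ?thesis by metis
qed

text \<open>Without a cross, heads move weakly to the right as tails move to the right, so segments
  from distinct tails stay apart strictly below the top line.\<close>

lemma bipartite_strip_drawing:
  fixes E :: "('a \<times> 'a) set"
  assumes net: "network E ss ts" and nc: "\<not> crossed E ss ts" and bip: "E \<subseteq> set ss \<times> set ts"
  shows "\<exists>pt cv. strip_drawing E ss ts pt cv"
proof -
  have n: "distinct ss" "distinct ts" "set ss \<inter> set ts = {}" using net by (auto simp: network_def)
  obtain g :: "'a \<Rightarrow> real" where g: "sorted_wrt (\<lambda>x y. g x < g y) ss" "\<forall>x \<in> set ss. -1 < g x \<and> g x < 1"
    by (rule spread[OF n(1), of "-1" 1]) auto
  obtain h :: "'a \<Rightarrow> real" where h: "sorted_wrt (\<lambda>x y. h x < h y) ts" "\<forall>x \<in> set ts. -1 < h x \<and> h x < 1"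
    by (rule spread[OF n(2), of "-1" 1]) auto
  have gb: "before ss x y \<longleftrightarrow> g x < g y" if "x \<in> set ss" "y \<in> set ss" for x y
    using sorted_wrt_before[OF g(1)] before_total[OF that] by (metis less_asym less_irrefl)
  have hb: "before ts x y \<longleftrightarrow> h x < h y" if "x \<in> set ts" "y \<in> set ts" for x y
    using sorted_wrt_before[OF h(1)] before_total[OF that] by (metis less_asym less_irrefl)
  have gi: "x = y" if "x \<in> set ss" "y \<in> set ss" "g x = g y" for x y
    using sorted_wrt_before[OF g(1)] before_total[OF that(1,2)] that(3) by (metis less_irrefl)
  have hi: "x = y" if "x \<in> set ts" "y \<in> set ts" "h x = h y" for x y
    using sorted_wrt_before[OF h(1)] before_total[OF that(1,2)] that(3) by (metis less_irrefl)
  define pt where "pt w = (if w \<in> set ss then Complex (g w) 0 else Complex (h w) 1)" for w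
  define cv where "cv e = linepath (pt (fst e)) (pt (snd e))" for e
  have ptS: "pt w = Complex (g w) 0" if "w \<in> set ss" for w using that by (simp add: pt_def)
  have ptT: "pt w = Complex (h w) 1" if "w \<in> set ts" for w using that n by (auto simp: pt_def)
  have V: "Field E \<union> set ss \<union> set ts = set ss \<union> set ts" using bip by (auto simp: Field_def)
  \<comment> \<open>Two arcs in the opposite order would have four different ends and form a cross
    of one-arc walks.\<close>
  have mono: "h t \<le> h t'" if "(s, t) \<in> E" "(s', t') \<in> E" "g s < g s'" for s t s' t'
  proof (rule ccontr)
    assume "\<not> h t \<le> h t'"
    then have st: "s \<in> set ss" "s' \<in> set ss" "t \<in> set ts" "t' \<in> set ts" "h t' < h t"
      using that bip by auto
    then have "before ts t' t" "before ss s s'" using that(3) hb gb by simp_all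
    moreover have "dwalk E s {s, t} t" "dwalk E s' {s', t'} t'"
      using that by (auto intro!: dwalk.intros)
    moreover have "{s, t} \<inter> {s', t'} = {}" using that(3) n(3) st by auto
    ultimately show False using nc unfolding crossed_def by blast
  qed
  \<comment> \<open>All segments run from height 0 to height 1, so the height is a common
    parameter.\<close>
  have pc: "z \<in> path_image (cv (s, t)) \<longleftrightarrow>
      0 \<le> Im z \<and> Im z \<le> 1 \<and> Re z = g s + Im z * (h t - g s)" if "(s, t) \<in> E" for s t z
    using that bip ptS ptT by (auto simp: cv_def mem_segment_complex)
  have injV: "inj_on pt (set ss \<union> set ts)"
    by (rule inj_onI) (use gi hi in \<open>auto simp: ptS ptT\<close>)
  have ptstrip: "pt ` (set ss \<union> set ts) \<subseteq> strip"
    using g(2) h(2) by (auto simp: strip_def ptS ptT)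
  have meet: "path_image (cv (s, t)) \<inter> path_image (cv (s', t')) \<subseteq> pt ` ({s, t} \<inter> {s', t'})"
    if e: "(s, t) \<in> E" "(s', t') \<in> E" "(s, t) \<noteq> (s', t')" for s t s' t'
  proof
    fix z assume "z \<in> path_image (cv (s, t)) \<inter> path_image (cv (s', t'))"
    then have "z \<in> path_image (cv (s, t))" "z \<in> path_image (cv (s', t'))" by auto
    then obtain u where u: "0 \<le> u" "u \<le> 1" "Re z = g s + u * (h t - g s)" "Im z = u"
      "Re z = g s' + u * (h t' - g s')"
      using pc[OF e(1)] pc[OF e(2)] by metis
    have st: "s \<in> set ss" "s' \<in> set ss" "t \<in> set ts" "t' \<in> set ts" using e bip by auto
    \<comment> \<open>Equality of the abscissae at height \<open>u\<close>. For
      \<open>0 < u < 1\<close> and distinct tails, monotonicity gives the two sides incompatible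
      signs.\<close>
    have eq: "(1 - u) * (g s - g s') = u * (h t' - h t)" using u by (simp add: algebra_simps)
    consider "u = 0" | "u = 1" | "0 < u" "u < 1" using u by linarith
    then show "z \<in> pt ` ({s, t} \<inter> {s', t'})"
    proof cases
      case 1
      then have "s = s'" "z = pt s" using u gi st by (auto simp: ptS complex_eq_iff)
      then show ?thesis by auto
    next
      case 2
      then have "t = t'" "z = pt t" using u hi st by (auto simp: ptT complex_eq_iff)
      then show ?thesis by auto
    next
      case 3
      have "\<not> g s < g s'"
      proof
        assume "g s < g s'"
        then have "(1 - u) * (g s - g s') < 0" "0 \<le> u * (h t' - h t)"
          using 3 mono[OF e(1,2)] by (auto simp: mult_less_0_iff)
        then show False using eq by linarith
      qed
      moreover have "\<not> g s' < g s"
      proof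
        assume "g s' < g s"
        then have "(1 - u) * (g s - g s') > 0" "0 \<ge> u * (h t' - h t)"
          using 3 mono[OF e(2,1)] by (auto simp: mult_le_0_iff)
        then show False using eq by linarith
      qed
      ultimately have "g s = g s'" by simp
      then have "h t = h t'" using eq 3 by simp
      then show ?thesis using e(3) \<open>g s = g s'\<close> gi hi st by auto
    qed
  qed
  have vert: "w \<in> {s, t}" if e: "(s, t) \<in> E" and w: "w \<in> set ss \<union> set ts" "pt w \<in> path_image (cv (s, t))" for s t w
  proof -
    have st: "s \<in> set ss" "t \<in> set ts" using e bip by auto
    obtain u where u: "Re (pt w) = g s + u * (h t - g s)" "Im (pt w) = u" using w(2) pc[OF e] by auto
    from w(1) show ?thesis
    proof
      assume "w \<in> set ss" then show ?thesis using u gi[of w s] st by (auto simp: ptS)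
    next
      assume "w \<in> set ts" then show ?thesis using u hi[of w t] st by (auto simp: ptT)
    qed
  qed
  have "strip_drawing E ss ts pt cv"
    unfolding strip_drawing_def plane_drawing_in_def pre_digraph.simps V
  proof (intro conjI ballI impI)
    fix e assume e: "e \<in> E"
    obtain s t where st: "e = (s, t)" "s \<in> set ss" "t \<in> set ts" using e bip by auto
    have "pt s \<noteq> pt t" using st by (simp add: ptS ptT)
    then show "arc (cv e)" by (simp add: cv_def st)
    show "path_image (cv e) \<subseteq> strip"
      using ptstrip st closed_segment_subset[OF _ _ convex_strip, of "pt s" "pt t"]
      by (simp add: cv_def image_subset_iff)
    show "pathstart (cv e) = pt (fst e)" "pathfinish (cv e) = pt (snd e)" by (auto simp: cv_def)
    show "w \<in> {fst e, snd e}" if "w \<in> set ss \<union> set ts" "pt w \<in> path_image (cv e)" for w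
      using vert[of s t w] e st that by auto
    show "z \<in> pt ` set ss" if "z \<in> path_image (cv e)" "Im z = 0" for z
    proof -
      have "z = pt s" using that pc[of s t z] e st by (auto simp: ptS complex_eq_iff)
      then show ?thesis using st by auto
    qed
    show "path_image (cv e) \<inter> path_image (cv f) \<subseteq> pt ` ({fst e, snd e} \<inter> {fst f, snd f})"
      if "f \<in> E" "e \<noteq> f" for f
      using meet[of s t "fst f" "snd f"] e st that by auto
  next
    show "sorted_wrt (\<lambda>x y. Re (pt x) < Re (pt y)) ss" "sorted_wrt (\<lambda>x y. Re (pt x) < Re (pt y)) ts"
      by (rule sorted_wrt_mono_rel[OF _ g(1)] sorted_wrt_mono_rel[OF _ h(1)]; simp add: ptS ptT)+
  next
    show "w \<in> set ss" if "w \<in> set ss \<union> set ts" "Im (pt w) = 0" for w using that by (auto simp: ptT)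
  qed (use injV ptstrip in \<open>auto simp: ptS ptT\<close>)
  then show ?thesis by blast
qed

text \<open>The bound 1/2 leaves room below the top line, so that the lifting map stays injective.
  The last property says that segments from the base to the apex do not rise above the tent.\<close>

lemma tent:
  fixes l m r :: real
  assumes "l < m" "m < r"
  obtains h :: "real \<Rightarrow> real" where "continuous_on UNIV h" "\<And>x. 0 \<le> h x \<and> h x \<le> 1 / 2" "h m = 1 / 2"
    "\<And>x. h x = 0 \<longleftrightarrow> x \<le> l \<or> r \<le> x"
    "\<And>p u. l \<le> p \<Longrightarrow> p \<le> r \<Longrightarrow> 0 \<le> u \<Longrightarrow> u \<le> 1 \<Longrightarrow> u / 2 \<le> h (p + u * (m - p))"
proof -
  \<comment> \<open>Half the minimum of the two linear functions with value 1 at \<open>m\<close>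
    that vanish at \<open>l\<close> and at \<open>r\<close>, cut off below at 0.\<close>
  define h where "h x = max 0 (min ((x - l) / (m - l)) ((r - x) / (r - m))) / 2" for x
  have "continuous_on UNIV h"
    unfolding h_def[abs_def] using assms by (intro continuous_intros) auto
  moreover have "0 \<le> h x \<and> h x \<le> 1 / 2" for x
  proof -
    have "(x - l) / (m - l) \<le> 1 \<or> (r - x) / (r - m) \<le> 1" using assms by (auto simp: divide_simps)
    then show ?thesis by (auto simp: h_def)
  qed
  moreover have "h m = 1 / 2" using assms by (simp add: h_def)
  moreover have "h x = 0 \<longleftrightarrow> x \<le> l \<or> r \<le> x" for x
  proof -
    have "max 0 (min p q) / 2 = 0 \<longleftrightarrow> p \<le> 0 \<or> q \<le> 0" for p q :: real
      by (auto simp: min_def max_def)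
    then have "h x = 0 \<longleftrightarrow> (x - l) / (m - l) \<le> 0 \<or> (r - x) / (r - m) \<le> 0"
      by (simp only: h_def)
    also have "\<dots> \<longleftrightarrow> x \<le> l \<or> r \<le> x" using assms by (simp add: divide_le_0_iff)
    finally show ?thesis .
  qed
  moreover have "u / 2 \<le> h (p + u * (m - p))" if "l \<le> p" "p \<le> r" "0 \<le> u" "u \<le> 1" for p u
  proof -
    have "0 \<le> (1 - u) * (p - l)" "0 \<le> (1 - u) * (r - p)" using that by auto
    then have "u * (m - l) \<le> p + u * (m - p) - l" "u * (r - m) \<le> r - (p + u * (m - p))"
      by (simp_all add: algebra_simps)
    then have "u \<le> (p + u * (m - p) - l) / (m - l)" "u \<le> (r - (p + u * (m - p))) / (r - m)"
      using assms by (simp_all add: pos_le_divide_eq)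
    then show ?thesis by (simp add: h_def)
  qed
  ultimately show ?thesis using that by blast
qed

text \<open>The bottom line is lifted to a tent with apex at \<open>v\<close> and feet at \<open>a\<close> and \<open>c\<close>. The triangle that
  this frees contains the segments from \<open>v\<close> to its in-neighbours on the bottom line.\<close>

lemma star_strip_drawing:
  fixes E :: "('a \<times> 'a) set"
  assumes net: "network E (A @ a # M @ c # C) ts"
    and av: "(a, v) \<in> E" and cv: "(c, v) \<in> E" and inv: "E\<inverse> `` {v} \<subseteq> {a, c} \<union> set M"
    and M: "E `` set M \<subseteq> {v}" and v: "v \<notin> set ts"
    and draw: "strip_drawing (E - UNIV \<times> {v}) (A @ a # v # c # C) ts pt cv"
  shows "\<exists>pt cv. strip_drawing E (A @ a # M @ c # C) ts pt cv"
proof -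
  let ?ss = "A @ a # M @ c # C" and ?ss' = "A @ a # v # c # C" and ?E = "E - UNIV \<times> {v}"
  let ?V = "Field E \<union> set ?ss \<union> set ts" and ?V' = "Field ?E \<union> set ?ss' \<union> set ts"
  have n: "distinct ?ss" "distinct ts" "set ?ss \<inter> set ts = {}" "set ?ss \<inter> Range E = {}"
    using net unfolding network_def by blast+
  have vss: "v \<notin> set ?ss" using n(4) av by auto
  \<comment> \<open>All arcs at the sources in \<open>M\<close> are deleted, so these vertices are
    absent from the smaller network and can be placed freely.\<close>
  have sep: "set M \<inter> ?V' = {}"
  proof -
    have "set M \<inter> Field ?E = {}" using n(4) M by (auto simp: Field_def)
    then show ?thesis using n(1,3) vss by auto
  qed
  have V: "?V = ?V' \<union> set M"
  proof -
    have "Field E \<subseteq> Field ?E \<union> {v, a, c} \<union> set M"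
      using inv by (auto simp: Field_def)
    moreover have "v \<in> Field E" "Field ?E \<subseteq> Field E" using av by (auto simp: Field_def)
    ultimately show ?thesis by auto
  qed
  note d = draw[unfolded strip_drawing_def]
  have d0: "plane_drawing_in strip (network_graph ?E ?ss' ts) pt cv"
    and dss: "sorted_wrt (\<lambda>x y. Re (pt x) < Re (pt y)) ?ss'"
    and dts: "sorted_wrt (\<lambda>x y. Re (pt x) < Re (pt y)) ts"
    and ds0: "\<And>s. s \<in> set ?ss' \<Longrightarrow> Im (pt s) = 0"
    and dt1: "\<And>t. t \<in> set ts \<Longrightarrow> Im (pt t) = 1"
    and dv0: "\<And>w. w \<in> ?V' \<Longrightarrow> Im (pt w) = 0 \<Longrightarrow> w \<in> set ?ss'"
    and dcv0: "\<And>e z. e \<in> ?E \<Longrightarrow> z \<in> path_image (cv e) \<Longrightarrow> Im z = 0 \<Longrightarrow> z \<in> pt ` set ?ss'"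
    using d by blast+
  define l m r where "l = Re (pt a)" and "m = Re (pt v)" and "r = Re (pt c)"
  have lmr: "l < m" "m < r" and A_l: "\<And>x. x \<in> set A \<Longrightarrow> Re (pt x) < l"
    and C_r: "\<And>x. x \<in> set C \<Longrightarrow> r < Re (pt x)"
    using dss by (auto simp: l_def m_def r_def sorted_wrt_append)
  obtain h :: "real \<Rightarrow> real" where hc: "continuous_on UNIV h" and h01: "\<And>x. 0 \<le> h x \<and> h x \<le> 1 / 2"
    and hm: "h m = 1 / 2" and h0: "\<And>x. h x = 0 \<longleftrightarrow> x \<le> l \<or> r \<le> x"
    and hline: "\<And>p u. l \<le> p \<Longrightarrow> p \<le> r \<Longrightarrow> 0 \<le> u \<Longrightarrow> u \<le> 1 \<Longrightarrow> u / 2 \<le> h (p + u * (m - p))"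
    using tent[OF lmr] by blast
  \<comment> \<open>Each vertical segment is compressed affinely from \<open>[0, 1]\<close> onto
    \<open>[h, 1]\<close>: the top line is fixed and the bottom line becomes the tent.\<close>
  define \<phi> where "\<phi> z = Complex (Re z) (Im z + (1 - Im z) * h (Re z))" for z
  have Re\<phi>: "Re (\<phi> z) = Re z" and Im\<phi>: "Im (\<phi> z) = h (Re z) + Im z * (1 - h (Re z))" for z
    by (simp_all add: \<phi>_def algebra_simps)
  have \<phi>_above: "h (Re z) \<le> Im (\<phi> z)" if "0 \<le> Im z" for z
    using that h01[of "Re z"] unfolding Im\<phi> by simp
  \<comment> \<open>Only points of the bottom line are sent to the tent or below it; this keeps old
    curves out of the triangle.\<close>
  have \<phi>_bottom: "Im z = 0" if "0 \<le> Im z" "Im (\<phi> z) \<le> h (Re z)" for z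
  proof -
    have "Im z * (1 - h (Re z)) \<le> 0" using that(2) by (simp add: Im\<phi>)
    moreover have "1 - h (Re z) > 0" using h01[of "Re z"] by linarith
    ultimately show ?thesis using that(1) by (simp add: mult_le_0_iff)
  qed
  have \<phi>c: "continuous_on strip \<phi>"
  proof -
    have "continuous_on strip (\<lambda>z. h (Re z))"
      by (rule continuous_on_compose2[OF hc]) (auto intro: continuous_intros)
    then show ?thesis unfolding \<phi>_def[abs_def] complex_eq_iff
      by (auto simp: Complex_eq intro!: continuous_intros)
  qed
  have \<phi>i: "inj_on \<phi> strip"
  proof (rule inj_onI)
    fix z w assume "\<phi> z = \<phi> w"
    then have "Re z = Re w" "Im (\<phi> z) = Im (\<phi> w)" using Re\<phi> by metis+
    moreover have "1 - h (Re w) \<noteq> 0" using h01[of "Re w"] by linarith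
    ultimately show "z = w" by (simp add: Im\<phi> complex_eq_iff)
  qed
  have \<phi>s: "\<phi> ` strip \<subseteq> strip"
  proof clarify
    fix z assume z: "z \<in> strip"
    have "0 \<le> (1 - Im z) * (1 - h (Re z))"
      using z h01[of "Re z"] by (intro mult_nonneg_nonneg) (auto simp: strip_def)
    then have "Im (\<phi> z) \<le> 1" by (simp add: Im\<phi> algebra_simps)
    then show "\<phi> z \<in> strip"
      using z \<phi>_above[of z] h01[of "Re z"] by (auto simp: strip_def Re\<phi>)
  qed
  have pd: "plane_drawing_in strip (network_graph ?E ?ss' ts) (\<phi> \<circ> pt) (\<lambda>e. \<phi> \<circ> cv e)"
    by (rule plane_drawing_in_image[OF d0 \<phi>c \<phi>i \<phi>s]) (auto simp: Field_def)
  have p_inj: "inj_on (\<phi> \<circ> pt) ?V'" and p_strip: "\<And>w. w \<in> ?V' \<Longrightarrow> \<phi> (pt w) \<in> strip"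
    and p_arc: "\<And>e. e \<in> ?E \<Longrightarrow> arc (\<phi> \<circ> cv e) \<and> path_image (\<phi> \<circ> cv e) \<subseteq> strip \<and>
        pathstart (\<phi> \<circ> cv e) = \<phi> (pt (fst e)) \<and> pathfinish (\<phi> \<circ> cv e) = \<phi> (pt (snd e))"
    and p_vert: "\<And>e w. e \<in> ?E \<Longrightarrow> w \<in> ?V' \<Longrightarrow> \<phi> (pt w) \<in> path_image (\<phi> \<circ> cv e) \<Longrightarrow> w \<in> {fst e, snd e}"
    and p_meet: "\<And>e f. e \<in> ?E \<Longrightarrow> f \<in> ?E \<Longrightarrow> e \<noteq> f \<Longrightarrow>
        path_image (\<phi> \<circ> cv e) \<inter> path_image (\<phi> \<circ> cv f) \<subseteq> (\<phi> \<circ> pt) ` ({fst e, snd e} \<inter> {fst f, snd f})"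
    using plane_drawing_inD[OF pd] unfolding pre_digraph.simps o_apply[of \<phi> pt] by blast+
  have d_strip: "\<And>w. w \<in> ?V' \<Longrightarrow> pt w \<in> strip"
    and d_arc: "\<And>e. e \<in> ?E \<Longrightarrow> path_image (cv e) \<subseteq> strip"
    and d_vert: "\<And>e w. e \<in> ?E \<Longrightarrow> w \<in> ?V' \<Longrightarrow> pt w \<in> path_image (cv e) \<Longrightarrow> w \<in> {fst e, snd e}"
    using plane_drawing_inD[OF d0] unfolding pre_digraph.simps by blast+
  have lr1: "-1 < l" "r < 1" using d_strip[of a] d_strip[of c] by (auto simp: strip_def l_def r_def)
  obtain g :: "'a \<Rightarrow> real" where gs: "sorted_wrt (\<lambda>x y. g x < g y) M"
    and glr: "\<forall>x \<in> set M. l < g x \<and> g x < r"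
    using spread[of M l r] n(1) lmr by auto
  have gi: "x = y" if "x \<in> set M" "y \<in> set M" "g x = g y" for x y
    using sorted_wrt_before[OF gs] before_total[OF that(1,2)] that(3) by (metis less_irrefl)
  define pt' where "pt' w = (if w \<in> set M then Complex (g w) 0 else \<phi> (pt w))" for w
  define cv' where "cv' e = (if snd e = v then linepath (pt' (fst e)) (pt' v) else \<phi> \<circ> cv e)" for e
  have ptM: "pt' w = Complex (g w) 0" if "w \<in> set M" for w using that by (simp add: pt'_def)
  have ptV: "pt' w = \<phi> (pt w)" if "w \<in> ?V'" for w using that sep by (auto simp: pt'_def)
  have ptv: "pt' v = Complex m (1 / 2)"
    using ptV[of v] ds0[of v] hm by (simp add: complex_eq_iff Re\<phi> Im\<phi> m_def)
  \<comment> \<open>The tent vanishes outside the open interval from \<open>l\<close> to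
    \<open>r\<close>, and \<open>v\<close> is the only source of the smaller network inside
    it.\<close>
  have fixed: "pt' s = pt s" if "s \<in> set ?ss' - {v}" for s
  proof -
    have "h (Re (pt s)) = 0" unfolding h0 using that A_l[of s] C_r[of s] by (auto simp: l_def r_def)
    then show ?thesis using ptV[of s] that by (auto simp: complex_eq_iff Re\<phi> Im\<phi>)
  qed
  have inV: "0 \<le> Im (pt w)" if "w \<in> ?V'" for w using d_strip[OF that] by (simp add: strip_def)
  have inj: "inj_on pt' ?V"
  proof (rule inj_onI)
    \<comment> \<open>The points for \<open>M\<close> have height 0 strictly between the feet, where
      the tent is positive, and lifted vertices do not lie below the tent.\<close>
    have mixed: "pt' x \<noteq> pt' y" if "x \<in> set M" "y \<in> ?V'" for x y
    proof
      assume "pt' x = pt' y"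
      then have eq: "\<phi> (pt y) = Complex (g x) 0" using ptM that ptV by metis
      then have "h (Re (pt y)) \<le> 0" using \<phi>_above[OF inV[OF that(2)]] by simp
      then have "h (Re (pt y)) = 0" using h01[of "Re (pt y)"] by linarith
      moreover have "Re (pt y) = g x" using eq Re\<phi>[of "pt y"] by simp
      ultimately show False using h0 glr that(1) by force
    qed
    fix x y assume "x \<in> ?V" "y \<in> ?V" and eq: "pt' x = pt' y"
    then consider "x \<in> set M" "y \<in> set M" | "x \<in> ?V'" "y \<in> ?V'" | "x \<in> set M" "y \<in> ?V'" | "x \<in> ?V'" "y \<in> set M"
      unfolding V by blast
    then show "x = y"
    proof cases
      case 1 then show ?thesis using eq ptM gi by simp
    next
      case 2
      then have "(\<phi> \<circ> pt) x = (\<phi> \<circ> pt) y" using eq ptV by simp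
      then show ?thesis using inj_onD[OF p_inj] 2 by blast
    next
      case 3 then show ?thesis using eq mixed by metis
    next
      case 4 then show ?thesis using eq mixed by metis
    qed
  qed
  have pt_strip: "pt' w \<in> strip" if "w \<in> ?V" for w
  proof (cases "w \<in> set M")
    case True
    then show ?thesis using glr lr1 ptM by (force simp: strip_def)
  next
    case False
    then show ?thesis using that p_strip[of w] ptV[of w] unfolding V by simp
  qed
  \<comment> \<open>Contains all tails of deleted arcs. The facts on segments to \<open>v\<close>
    are proved for every element, whichever elements of \<open>M\<close> send an arc to
    \<open>v\<close>.\<close>
  define N where "N = {a, c} \<union> set M"
  have NV: "N \<subseteq> ?V" by (auto simp: N_def)
  have ptN: "l \<le> Re (pt' s) \<and> Re (pt' s) \<le> r \<and> Im (pt' s) = 0" if "s \<in> N" for s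
  proof -
    have "pt' a = pt a" "pt' c = pt c" using fixed vss by auto
    then have "Re (pt' a) = l" "Re (pt' c) = r" "Im (pt' a) = 0" "Im (pt' c) = 0"
      using ds0 by (auto simp: l_def r_def)
    then show ?thesis using that glr lmr ptM by (force simp: N_def)
  qed
  have spoke: "cv' (s, v) = linepath (pt' s) (pt' v)" for s by (simp add: cv'_def)
  have old: "cv' e = \<phi> \<circ> cv e" if "e \<in> ?E" for e using that by (cases e) (auto simp: cv'_def)
  have on_spoke: "\<exists>u. 0 \<le> u \<and> u \<le> 1 \<and> Re z = Re (pt' s) + u * (m - Re (pt' s)) \<and> Im z = u / 2"
    if "s \<in> N" "z \<in> path_image (cv' (s, v))" for s z
    using that ptN[of s] by (auto simp: spoke mem_segment_complex ptv)
  have spoke_below: "Im z \<le> h (Re z) \<and> l \<le> Re z \<and> Re z \<le> r"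
    if s: "s \<in> N" and z: "z \<in> path_image (cv' (s, v))" for s z
  proof -
    obtain u where u: "0 \<le> u" "u \<le> 1" "Re z = Re (pt' s) + u * (m - Re (pt' s))" "Im z = u / 2"
      using on_spoke[OF s z] by blast
    have "0 \<le> (1 - u) * (Re (pt' s) - l)" "0 \<le> (1 - u) * (r - Re (pt' s))"
      "0 \<le> u * (m - l)" "0 \<le> u * (r - m)" using u ptN[OF s] lmr by auto
    then have "l \<le> Re z" "Re z \<le> r" unfolding u(3) by (simp_all add: algebra_simps)
    then show ?thesis using u ptN[OF s] hline[of "Re (pt' s)" u] by simp
  qed
  have spoke_bottom: "z = pt' s" if s: "s \<in> N" and z: "z \<in> path_image (cv' (s, v))" and "Im z = 0" for s z
    using on_spoke[OF s z] that(3) ptN[OF s] by (auto simp: complex_eq_iff)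
  have spoke_vert: "w \<in> {s, v}"
    if s: "s \<in> N" and z: "pt' w \<in> path_image (cv' (s, v))" and w: "w \<in> ?V" for s w
  proof (cases "w = v \<or> Im (pt' w) = 0")
    case True
    then show ?thesis using spoke_bottom[OF s z] inj_onD[OF inj] w s NV by blast
  next
    case False
    then have "w \<notin> set M" using ptM by force
    then have w': "w \<in> ?V'" using w V by blast
    have "Im (pt w) = 0"
      using \<phi>_bottom[OF inV[OF w']] spoke_below[OF s z] ptV[OF w'] Re\<phi> by simp
    then have "w \<in> set ?ss' - {v}" using dv0[OF w'] False by blast
    then have "Im (pt' w) = 0" using fixed[of w] ds0[of w] by auto
    then show ?thesis using False by simp
  qed
  \<comment> \<open>A common point does not lie above the tent, hence comes from the bottom line,
    which old curves meet only in source points; so it is a vertex.\<close>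
  have spoke_old: "z \<in> pt' ` ({s, v} \<inter> {fst e, snd e})"
    if s: "s \<in> N" and z: "z \<in> path_image (cv' (s, v))" and e: "e \<in> ?E" "z \<in> path_image (cv' e)" for s e z
  proof -
    obtain y where y: "y \<in> path_image (cv e)" "z = \<phi> y"
      using e by (auto simp: old path_image_compose)
    have "y \<in> strip" using d_arc e(1) y(1) by blast
    then have "Im y = 0" using \<phi>_bottom[of y] spoke_below[OF s z] Re\<phi> y(2) by (simp add: strip_def)
    then obtain w where w: "w \<in> set ?ss'" "y = pt w" using dcv0[OF e(1) y(1)] by blast
    then have w': "w \<in> ?V'" by auto
    have "w \<in> {fst e, snd e}" using d_vert[OF e(1) w'] y(1) w(2) by simp
    moreover have zw: "z = pt' w" using y(2) w(2) ptV[OF w'] by simp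
    then have "w \<in> {s, v}" using spoke_vert[OF s] z w' V by blast
    ultimately show ?thesis using zw by blast
  qed
  \<comment> \<open>At equal heights \<open>u / 2\<close> the horizontal gap is \<open>1 - u\<close>
    times the gap at the bottom, so it closes only at \<open>v\<close>.\<close>
  have spoke_spoke: "z = pt' v"
    if s: "s \<in> N" and z: "z \<in> path_image (cv' (s, v))"
      and s': "s' \<in> N" and z': "z \<in> path_image (cv' (s', v))" and ne: "s \<noteq> s'" for s s' z
  proof -
    obtain u where u: "Re z = Re (pt' s) + u * (m - Re (pt' s))" "Im z = u / 2"
      using on_spoke[OF s z] by blast
    obtain u' where u': "Re z = Re (pt' s') + u' * (m - Re (pt' s'))" "Im z = u' / 2"
      using on_spoke[OF s' z'] by blast
    have "u = u'" using u(2) u'(2) by simp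
    then have "(1 - u) * (Re (pt' s) - Re (pt' s')) = 0" using u(1) u'(1) by (simp add: algebra_simps)
    moreover have "Re (pt' s) \<noteq> Re (pt' s')"
    proof
      assume "Re (pt' s) = Re (pt' s')"
      then have "pt' s = pt' s'" using ptN[OF s] ptN[OF s'] by (simp add: complex_eq_iff)
      then show False using inj_onD[OF inj] s s' NV ne by blast
    qed
    ultimately have "u = 1" by simp
    then show ?thesis using u by (simp add: complex_eq_iff ptv)
  qed
  have edge_cases: "e \<in> ?E \<or> (\<exists>s \<in> N. e = (s, v))" if "e \<in> E" for e
    using that inv by (cases e) (auto simp: N_def)
  have EV: "fst e \<in> ?V \<and> snd e \<in> ?V" if "e \<in> E" for e using that by (cases e) (auto simp: Field_def)
  have EV': "fst e \<in> ?V' \<and> snd e \<in> ?V'" if "e \<in> ?E" for e using that by (cases e) (auto simp: Field_def)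
  have "strip_drawing E ?ss ts pt' cv'"
    unfolding strip_drawing_def plane_drawing_in_def pre_digraph.simps
  proof (intro conjI ballI impI)
    show "inj_on pt' ?V" by (rule inj)
    show "pt' ` ?V \<subseteq> strip" using pt_strip by blast
  next
    fix e assume e: "e \<in> E"
    from edge_cases[OF e]
    have "arc (cv' e) \<and> path_image (cv' e) \<subseteq> strip \<and> pathstart (cv' e) = pt' (fst e) \<and> pathfinish (cv' e) = pt' (snd e)"
    proof
      assume "e \<in> ?E"
      then show ?thesis using p_arc[of e] old[of e] EV'[of e] ptV by simp
    next
      assume "\<exists>s \<in> N. e = (s, v)"
      then obtain s where s: "s \<in> N" "e = (s, v)" by blast
      have "pt' s \<noteq> pt' v" using ptN[OF s(1)] ptv by force
      moreover have "closed_segment (pt' s) (pt' v) \<subseteq> strip"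
        using EV[OF e] s(2) pt_strip by (intro closed_segment_subset convex_strip) auto
      ultimately show ?thesis using s by (simp add: spoke)
    qed
    then show "arc (cv' e)" "path_image (cv' e) \<subseteq> strip" "pathstart (cv' e) = pt' (fst e)"
      "pathfinish (cv' e) = pt' (snd e)" by blast+
  next
    fix e w assume e: "e \<in> E" and w: "w \<in> ?V" "pt' w \<in> path_image (cv' e)"
    from edge_cases[OF e] show "w \<in> {fst e, snd e}"
    proof
      assume e': "e \<in> ?E"
      then obtain y where y: "y \<in> path_image (cv e)" "pt' w = \<phi> y"
        using w(2) by (auto simp: old path_image_compose)
      have ys: "y \<in> strip" using d_arc e' y(1) by blast
      show ?thesis
      proof (cases "w \<in> set M")
        case True
        then have eq: "\<phi> y = Complex (g w) 0" using y(2) ptM by simp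
        have "h (Re y) \<le> 0" using \<phi>_above[of y] ys eq by (simp add: strip_def)
        then have "h (Re y) = 0" using h01[of "Re y"] by linarith
        moreover have "Re y = g w" using eq Re\<phi>[of y] by simp
        ultimately show ?thesis using h0 glr True by force
      next
        case False
        then have "w \<in> ?V'" using w(1) V by blast
        then show ?thesis using p_vert[OF e'] w(2) ptV old[OF e'] by simp
      qed
    next
      assume "\<exists>s \<in> N. e = (s, v)"
      then obtain s where s: "s \<in> N" "e = (s, v)" by blast
      then show ?thesis using spoke_vert[OF s(1) _ w(1)] w(2) by simp
    qed
  next
    fix e f assume e: "e \<in> E" and f: "f \<in> E" and ne: "e \<noteq> f"
    show "path_image (cv' e) \<inter> path_image (cv' f) \<subseteq> pt' ` ({fst e, snd e} \<inter> {fst f, snd f})"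
    proof
      fix z assume "z \<in> path_image (cv' e) \<inter> path_image (cv' f)"
      then have z: "z \<in> path_image (cv' e)" "z \<in> path_image (cv' f)" by auto
      from edge_cases[OF e] edge_cases[OF f]
      show "z \<in> pt' ` ({fst e, snd e} \<inter> {fst f, snd f})"
      proof (elim disjE)
        assume ef: "e \<in> ?E" "f \<in> ?E"
        then obtain w where w: "w \<in> {fst e, snd e} \<inter> {fst f, snd f}" "z = \<phi> (pt w)"
          using p_meet[OF ef ne] z old by auto
        then have "w \<in> ?V'" using EV'[OF ef(1)] by blast
        then have "z = pt' w" using ptV w(2) by simp
        then show ?thesis using w(1) by blast
      next
        assume ef: "e \<in> ?E" "\<exists>s \<in> N. f = (s, v)"
        then obtain s where s: "s \<in> N" "f = (s, v)" by blast
        show ?thesis using spoke_old[OF s(1) _ ef(1), of z] z s(2) by auto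
      next
        assume ef: "\<exists>s \<in> N. e = (s, v)" "f \<in> ?E"
        then obtain s where s: "s \<in> N" "e = (s, v)" by blast
        show ?thesis using spoke_old[OF s(1) _ ef(2), of z] z s(2) by auto
      next
        assume ef: "\<exists>s \<in> N. e = (s, v)" "\<exists>s \<in> N. f = (s, v)"
        then obtain s s' where s: "s \<in> N" "e = (s, v)" "s' \<in> N" "f = (s', v)" by blast
        then have "z = pt' v" using spoke_spoke[OF s(1) _ s(3)] z ne by blast
        then show ?thesis using s(2,4) by simp
      qed
    qed
  next
    have 1: "sorted_wrt (\<lambda>x y. Re (pt' x) < Re (pt' y)) M"
      by (rule sorted_wrt_mono_rel[OF _ gs]) (simp add: ptM)
    have Re_fixed: "Re (pt' s) = Re (pt s)" if "s \<in> set (A @ a # c # C)" for s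
    proof -
      have "s \<noteq> v" using that vss by auto
      then show ?thesis using fixed[of s] that by auto
    qed
    have "sorted_wrt (\<lambda>x y. Re (pt x) < Re (pt y)) (A @ a # c # C)"
      using dss by (auto simp: sorted_wrt_append)
    then have 2: "sorted_wrt (\<lambda>x y. Re (pt' x) < Re (pt' y)) (A @ a # c # C)"
      by (rule sorted_wrt_mono_rel[rotated]) (simp only: Re_fixed)
    have "Re (pt' x) < l" if "x \<in> set A" for x using Re_fixed[of x] A_l[of x] that by simp
    moreover have "r < Re (pt' x)" if "x \<in> set C" for x using Re_fixed[of x] C_r[of x] that by simp
    moreover have "Re (pt' a) = l" "Re (pt' c) = r" using Re_fixed by (simp_all add: l_def r_def)
    moreover have "l < Re (pt' x) \<and> Re (pt' x) < r" if "x \<in> set M" for x using glr ptM that by simp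
    ultimately show "sorted_wrt (\<lambda>x y. Re (pt' x) < Re (pt' y)) ?ss"
      using 1 2 by (auto simp: sorted_wrt_append intro: less_trans)
  next
    have "Re (pt' t) = Re (pt t)" if "t \<in> set ts" for t using ptV[of t] that Re\<phi> by simp
    then show "sorted_wrt (\<lambda>x y. Re (pt' x) < Re (pt' y)) ts"
      by (intro sorted_wrt_mono_rel[OF _ dts]) simp
  next
    fix s assume s: "s \<in> set ?ss"
    then have "s \<noteq> v" using vss by blast
    then show "Im (pt' s) = 0" using s fixed[of s] ds0[of s] ptM[of s] by auto
  next
    fix t assume "t \<in> set ts"
    then show "Im (pt' t) = 1" using ptV[of t] dt1[of t] by (simp add: Im\<phi>)
  next
    fix w assume w: "w \<in> ?V" "Im (pt' w) = 0"
    show "w \<in> set ?ss"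
    proof (cases "w \<in> set M")
      case False
      then have w': "w \<in> ?V'" using w(1) V by blast
      have "Im (pt w) = 0"
        using \<phi>_bottom[OF inV[OF w']] h01[of "Re (pt w)"] w(2) ptV[OF w'] by simp
      then have "w \<in> set ?ss'" using dv0[OF w'] by blast
      moreover have "w \<noteq> v" using w(2) ptv by auto
      ultimately show ?thesis by auto
    qed auto
  next
    fix e z assume e: "e \<in> E" and z: "z \<in> path_image (cv' e)" "Im z = 0"
    from edge_cases[OF e] show "z \<in> pt' ` set ?ss"
    proof
      assume e': "e \<in> ?E"
      then obtain y where y: "y \<in> path_image (cv e)" "z = \<phi> y"
        using z(1) by (auto simp: old path_image_compose)
      have ys: "y \<in> strip" using d_arc e' y(1) by blast
      have "Im y = 0"
        using \<phi>_bottom[of y] ys h01[of "Re y"] y(2) z(2) by (simp add: strip_def)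
      then obtain w where w: "w \<in> set ?ss'" "y = pt w" using dcv0[OF e' y(1)] by blast
      then have zw: "z = pt' w" using y(2) w ptV[of w] by auto
      then have "w \<noteq> v" using z(2) ptv by auto
      then show ?thesis using w(1) zw by auto
    next
      assume "\<exists>s \<in> N. e = (s, v)"
      then obtain s where s: "s \<in> N" "e = (s, v)" by blast
      then have "z = pt' s" using spoke_bottom z by blast
      then show ?thesis using s(1) by (auto simp: N_def)
    qed
  qed
  then show ?thesis by blast
qed

text \<open>The list \<open>ss\<close> varies in the induction, because \<open>v\<close> becomes a
  source; \<open>ts\<close> stays fixed.\<close>

theorem strip_drawing_exists:
  "network E ss ts \<Longrightarrow> \<not> crossed E ss ts \<Longrightarrow> \<exists>pt cv. strip_drawing E ss ts pt cv"
proof (induction "card E" arbitrary: E ss rule: less_induct)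
  case less
  show ?case
  proof (cases "E \<subseteq> set ss \<times> set ts")
    case True
    then show ?thesis using bipartite_strip_drawing less.prems by blast
  next
    case False
    obtain v where v: "v \<in> Field E" "v \<notin> set ss" "v \<notin> set ts" "E\<inverse> `` {v} \<subseteq> set ss"
      using exists_first_internal[OF less.prems(1) False] by blast
    obtain A a M c C where red: "ss = A @ a # M @ c # C"
      "(a, v) \<in> E" "(c, v) \<in> E" "E\<inverse> `` {v} \<subseteq> {a, c} \<union> set M" "E `` set M \<subseteq> {v}"
      "network (E - UNIV \<times> {v}) (A @ a # v # c # C) ts"
      "\<not> crossed (E - UNIV \<times> {v}) (A @ a # v # c # C) ts"
      using reduction[OF less.prems v] by blast
    have "card (E - UNIV \<times> {v}) < card E"
    proof (rule psubset_card_mono)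
      show "finite E" using less.prems(1) by (simp add: network_def)
      show "E - UNIV \<times> {v} \<subset> E" using red(2) by blast
    qed
    then obtain pt cv where "strip_drawing (E - UNIV \<times> {v}) (A @ a # v # c # C) ts pt cv"
      using less.hyps red(6,7) by blast
    then show ?thesis
      using star_strip_drawing[OF _ red(2-5) v(3)] less.prems(1) unfolding red(1) by blast
  qed
qed

section \<open>Interleaved paths in a disc\<close>

text \<open>Both paths are prolonged along the coordinate axes to the sides of a box, where
  \<open>fashoda\<close> applies. On each axis \<open>K\<close> lies between the ends of the
  respective path, so the prolongations meet \<open>K\<close> along their own axis in these ends
  only.\<close>

lemma fashoda_in_compact:
  fixes f g :: "real \<Rightarrow> real^2"
  assumes f: "path f" "path_image f \<subseteq> K" and g: "path g" "path_image g \<subseteq> K"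
    and K: "bounded K"
    and f0: "pathstart f $ 2 = 0" "pathstart f $ 1 < 0" and f1: "pathfinish f $ 2 = 0" "pathfinish f $ 1 > 0"
    and g0: "pathstart g $ 1 = 0" "pathstart g $ 2 < 0" and g1: "pathfinish g $ 1 = 0" "pathfinish g $ 2 > 0"
    and xax: "\<And>p. p \<in> K \<Longrightarrow> p $ 2 = 0 \<Longrightarrow> pathstart f $ 1 \<le> p $ 1 \<and> p $ 1 \<le> pathfinish f $ 1"
    and yax: "\<And>p. p \<in> K \<Longrightarrow> p $ 1 = 0 \<Longrightarrow> pathstart g $ 2 \<le> p $ 2 \<and> p $ 2 \<le> pathfinish g $ 2"
  shows "path_image f \<inter> path_image g \<noteq> {}"
proof -
  obtain B where B: "\<And>p. p \<in> K \<Longrightarrow> norm p \<le> B" using K by (auto simp: bounded_iff)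
  have coord: "\<bar>p $ i\<bar> \<le> B" if "p \<in> K" for p i
    using B[OF that] component_le_norm_cart[of p i] by linarith
  let ?a = "vector [-B, -B] :: real^2" and ?b = "vector [B, B] :: real^2"
  let ?W = "vector [-B, 0] :: real^2" and ?E = "vector [B, 0] :: real^2"
  let ?S = "vector [0, -B] :: real^2" and ?N = "vector [0, B] :: real^2"
  let ?f = "(linepath ?W (pathstart f) +++ f) +++ linepath (pathfinish f) ?E"
  let ?g = "(linepath ?S (pathstart g) +++ g) +++ linepath (pathfinish g) ?N"
  have box: "p \<in> cbox ?a ?b \<longleftrightarrow> \<bar>p $ 1\<bar> \<le> B \<and> \<bar>p $ 2\<bar> \<le> B" for p
    by (auto simp: mem_box_cart forall_2)
  have KB: "K \<subseteq> cbox ?a ?b" using coord by (auto simp: box)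
  have ends: "pathstart f \<in> K" "pathfinish f \<in> K" "pathstart g \<in> K" "pathfinish g \<in> K"
    using f g by auto
  have B0: "B \<ge> 0" using coord[OF ends(1), of 1] by linarith
  have corners: "?W \<in> cbox ?a ?b" "?E \<in> cbox ?a ?b" "?S \<in> cbox ?a ?b" "?N \<in> cbox ?a ?b"
    using B0 by (auto simp: box)
  have seg: "closed_segment p q \<subseteq> cbox ?a ?b" if "p \<in> cbox ?a ?b" "q \<in> cbox ?a ?b" for p q
    using that by (intro closed_segment_subset) auto
  have imf: "path_image ?f = closed_segment ?W (pathstart f) \<union> path_image f \<union> closed_segment (pathfinish f) ?E"
    by (simp add: path_image_join)
  have img: "path_image ?g = closed_segment ?S (pathstart g) \<union> path_image g \<union> closed_segment (pathfinish g) ?N"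
    by (simp add: path_image_join)
  obtain z where z: "z \<in> path_image ?f" "z \<in> path_image ?g"
  proof (rule fashoda[of ?f ?g ?a ?b])
    show "path_image ?f \<subseteq> cbox ?a ?b" "path_image ?g \<subseteq> cbox ?a ?b"
      unfolding imf img using f g KB seg corners ends by (meson Un_least order_trans subsetD)+
  qed (use f g in auto)
  have segs: "p $ 2 = 0 \<and> p $ 1 \<le> pathstart f $ 1" if "p \<in> closed_segment ?W (pathstart f)" for p
  proof -
    obtain u where u: "0 \<le> u" "u \<le> 1" "p = (1 - u) *\<^sub>R ?W + u *\<^sub>R pathstart f"
      using \<open>p \<in> _\<close> by (auto simp: in_segment)
    have "(1 - u) * (- B) \<le> (1 - u) * pathstart f $ 1"
      using coord[OF ends(1), of 1] u by (intro mult_left_mono) auto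
    moreover have "p $ 1 = (1 - u) * (- B) + u * pathstart f $ 1" "p $ 2 = u * pathstart f $ 2"
      by (simp_all add: u(3))
    ultimately show ?thesis using f0 by (simp add: algebra_simps)
  qed
  have sege: "p $ 2 = 0 \<and> p $ 1 \<ge> pathfinish f $ 1" if "p \<in> closed_segment (pathfinish f) ?E" for p
  proof -
    obtain u where u: "0 \<le> u" "u \<le> 1" "p = (1 - u) *\<^sub>R pathfinish f + u *\<^sub>R ?E"
      using \<open>p \<in> _\<close> by (auto simp: in_segment)
    have "u * pathfinish f $ 1 \<le> u * B"
      using coord[OF ends(2), of 1] u by (intro mult_left_mono) auto
    moreover have "p $ 1 = (1 - u) * pathfinish f $ 1 + u * B" "p $ 2 = (1 - u) * pathfinish f $ 2"
      by (simp_all add: u(3))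
    ultimately show ?thesis using f1 by (simp add: algebra_simps)
  qed
  have segs': "p $ 1 = 0 \<and> p $ 2 \<le> pathstart g $ 2" if "p \<in> closed_segment ?S (pathstart g)" for p
  proof -
    obtain u where u: "0 \<le> u" "u \<le> 1" "p = (1 - u) *\<^sub>R ?S + u *\<^sub>R pathstart g"
      using \<open>p \<in> _\<close> by (auto simp: in_segment)
    have "(1 - u) * (- B) \<le> (1 - u) * pathstart g $ 2"
      using coord[OF ends(3), of 2] u by (intro mult_left_mono) auto
    moreover have "p $ 1 = u * pathstart g $ 1" "p $ 2 = (1 - u) * (- B) + u * pathstart g $ 2"
      by (simp_all add: u(3))
    ultimately show ?thesis using g0 by (simp add: algebra_simps)
  qed
  have sege': "p $ 1 = 0 \<and> p $ 2 \<ge> pathfinish g $ 2" if "p \<in> closed_segment (pathfinish g) ?N" for p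
  proof -
    obtain u where u: "0 \<le> u" "u \<le> 1" "p = (1 - u) *\<^sub>R pathfinish g + u *\<^sub>R ?N"
      using \<open>p \<in> _\<close> by (auto simp: in_segment)
    have "u * pathfinish g $ 2 \<le> u * B"
      using coord[OF ends(4), of 2] u by (intro mult_left_mono) auto
    moreover have "p $ 1 = (1 - u) * pathfinish g $ 1" "p $ 2 = (1 - u) * pathfinish g $ 2 + u * B"
      by (simp_all add: u(3))
    ultimately show ?thesis using g1 by (simp add: algebra_simps)
  qed
  have fx: "p \<in> path_image f" if "p \<in> path_image ?f" "p \<in> K" for p
  proof -
    have "p = pathstart f" if "p $ 2 = 0" "p $ 1 = pathstart f $ 1"
      using that f0 by (simp add: vec_eq_iff forall_2)
    moreover have "p = pathfinish f" if "p $ 2 = 0" "p $ 1 = pathfinish f $ 1"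
      using that f1 by (simp add: vec_eq_iff forall_2)
    ultimately show ?thesis using that segs[of p] sege[of p] xax[of p] unfolding imf by fastforce
  qed
  have gx: "p \<in> path_image g" if "p \<in> path_image ?g" "p \<in> K" for p
  proof -
    have "p = pathstart g" if "p $ 1 = 0" "p $ 2 = pathstart g $ 2"
      using that g0 by (simp add: vec_eq_iff forall_2)
    moreover have "p = pathfinish g" if "p $ 1 = 0" "p $ 2 = pathfinish g $ 2"
      using that g1 by (simp add: vec_eq_iff forall_2)
    ultimately show ?thesis using that segs'[of p] sege'[of p] yax[of p] unfolding img by fastforce
  qed
  \<comment> \<open>Outside \<open>K\<close> the point would lie on prolongations of both paths,
    hence on both axes, but the horizontal prolongations miss the origin.\<close>
  have "z \<in> K"
  proof (rule ccontr)
    assume "z \<notin> K"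
    then have "z \<notin> path_image f" "z \<notin> path_image g" using f g by auto
    then show False using z segs[of z] sege[of z] segs'[of z] sege'[of z] f0 f1 g0 g1
      unfolding imf img by auto
  qed
  then show ?thesis using fx gx z by blast
qed

text \<open>Twice the signed area of the triangle with corners \<open>p\<close>, \<open>q\<close>, \<open>r\<close>.\<close>

definition orient :: "complex \<Rightarrow> complex \<Rightarrow> complex \<Rightarrow> real" where
  "orient p q r = (Re q - Re p) * (Im r - Im p) - (Im q - Im p) * (Re r - Re p)"

text \<open>Chords of the unit circle have length twice the sine of half the angle, so this is the
  area formula abc / (4R) with a sign, for R = 1.\<close>

lemma orient_cis:
  "orient (cis a) (cis b) (cis c) = 4 * sin ((b - a) / 2) * sin ((c - b) / 2) * sin ((c - a) / 2)"
proof -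
  define x y z where "x = a / 2" and "y = b / 2" and "z = c / 2"
  have *: "a = 2 * x" "b = 2 * y" "c = 2 * z" by (auto simp: x_def y_def z_def)
  have d: "cos (2 * u) - cos (2 * v) = 2 * sin (u + v) * sin (v - u)"
    "sin (2 * u) - sin (2 * v) = 2 * cos (u + v) * sin (u - v)" for u v :: real
    using cos_diff_cos[of "2 * u" "2 * v"] sin_diff_sin[of "2 * u" "2 * v"]
    by (simp_all add: add_divide_distrib diff_divide_distrib mult.commute mult.left_commute)
  have "orient (cis a) (cis b) (cis c) =
      (2 * sin (y + x) * sin (x - y)) * (2 * cos (z + x) * sin (z - x))
      - (2 * cos (y + x) * sin (y - x)) * (2 * sin (z + x) * sin (x - z))"
    by (simp add: orient_def * d)
  also have "\<dots> = 4 * sin (y - x) * sin (z - x) * (sin (z + x) * cos (y + x) - cos (z + x) * sin (y + x))"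
    using sin_minus[of "y - x"] sin_minus[of "z - x"] by (simp add: algebra_simps)
  also have "sin (z + x) * cos (y + x) - cos (z + x) * sin (y + x) = sin (z - y)"
    using sin_diff[of "z + x" "y + x"] by simp
  finally show ?thesis by (simp add: * diff_divide_distrib)
qed

lemma orient_cis_pos:
  assumes "a < b" "b < c" "c < a + 2 * pi"
  shows "orient (cis a) (cis b) (cis c) > 0"
  unfolding orient_cis using assms by (intro mult_pos_pos sin_gt_zero) (auto simp: field_simps)

text \<open>On the line through \<open>p\<close> and \<open>q\<close> the squared norm at parameter
  \<open>t\<close> is 1 plus \<open>t\<^sup>2 - t\<close> times the squared length of the
  chord.\<close>

lemma chord_in_disc:
  fixes p q z :: complex
  assumes "norm p = 1" "norm q = 1" "p \<noteq> q" and z: "z = p + t *\<^sub>R (q - p)" "norm z \<le> 1"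
  shows "0 \<le> t \<and> t \<le> 1"
proof -
  have n: "p \<bullet> p = 1" "q \<bullet> q = 1" "z \<bullet> z \<le> 1"
    using assms by (auto simp: dot_square_norm power_le_one)
  have pos: "(q - p) \<bullet> (q - p) > 0" using assms(3) by simp
  have "z \<bullet> z = 1 + (t\<^sup>2 - t) * ((q - p) \<bullet> (q - p))"
    using n(1,2) unfolding z(1)
    by (simp add: inner_diff_left inner_diff_right inner_add_left inner_add_right inner_commute
        algebra_simps power2_eq_square)
  then have "(t\<^sup>2 - t) * ((q - p) \<bullet> (q - p)) \<le> 0" using n(3) by simp
  then have "t\<^sup>2 - t \<le> 0" using pos by (metis mult_le_0_iff linorder_not_less)
  then have "t * (t - 1) \<le> 0" by (simp add: power2_eq_square algebra_simps)
  then show ?thesis by (auto simp: mult_le_0_iff)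
qed

text \<open>An affine change of coordinates puts the chord from \<open>cis a\<close> to
  \<open>cis c\<close> on the horizontal axis and the chord from \<open>cis b\<close> to
  \<open>cis d\<close> on the vertical one. \<open>chord_in_disc\<close> then shows that the disc
  meets the axes only in these chords.\<close>

lemma interleaved_paths_meet:
  assumes f: "path f" "path_image f \<subseteq> cball 0 1" "pathstart f = cis a" "pathfinish f = cis c"
    and g: "path g" "path_image g \<subseteq> cball 0 1" "pathstart g = cis b" "pathfinish g = cis d"
    and ord: "a < b" "b < c" "c < d" "d < a + 2 * pi"
  shows "path_image f \<inter> path_image g \<noteq> {}"
proof -
  define X where "X z = - orient (cis b) (cis d) z" for z
  define Y where "Y z = orient (cis a) (cis c) z" for z
  define T where "T z = (\<chi> i. if i = 1 then X z else Y z :: real^2)" for z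
  have T: "T z $ 1 = X z" "T z $ 2 = Y z" for z by (simp_all add: T_def)
  have pos: "orient (cis a) (cis b) (cis c) > 0" "orient (cis b) (cis c) (cis d) > 0"
      "orient (cis a) (cis c) (cis d) > 0" "orient (cis a) (cis b) (cis d) > 0"
    using ord by (auto intro!: orient_cis_pos)
  have sgn: "X (cis a) < 0" "X (cis c) > 0" "X (cis b) = 0" "X (cis d) = 0"
    "Y (cis b) < 0" "Y (cis d) > 0" "Y (cis a) = 0" "Y (cis c) = 0"
    using pos by (simp_all add: X_def Y_def orient_def algebra_simps)
  have contX: "continuous_on S X" and contY: "continuous_on S Y" for S
    unfolding X_def[abs_def] Y_def[abs_def] orient_def by (intro continuous_intros)+
  have contT: "continuous_on S T" for S
    unfolding T_def[abs_def]
  proof (rule continuous_on_vec_lambda)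
    show "continuous_on S (\<lambda>z. if i = 1 then X z else Y z)" for i :: 2
      using contX contY by (cases "i = 1") (simp_all cong: continuous_on_cong)
  qed
  \<comment> \<open>Twice the area of the quadrilateral with the four points as corners, split along
    one diagonal; the next fact splits it along the other.\<close>
  define \<Delta> where "\<Delta> = X (cis c) - X (cis a)"
  have \<Delta>': "\<Delta> = Y (cis d) - Y (cis b)"
    by (simp add: \<Delta>_def X_def Y_def orient_def algebra_simps)
  have \<Delta>: "\<Delta> > 0" using sgn by (simp add: \<Delta>_def)
  \<comment> \<open>Inverts the affine map: coordinate differences divided by \<Delta> are the
    coefficients along the two chords. This gives injectivity and the parameter \<open>t\<close> on
    each chord.\<close>
  have rep: "\<Delta> *\<^sub>R (z - w) = (X z - X w) *\<^sub>R (cis c - cis a) + (Y z - Y w) *\<^sub>R (cis d - cis b)" for z w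
    unfolding complex_eq_iff by (simp add: \<Delta>_def X_def Y_def orient_def algebra_simps)
  have inj: "inj T"
  proof (rule injI)
    fix z w assume "T z = T w"
    then have "X z = X w" "Y z = Y w" using T by metis+
    then show "z = w" using rep[of z w] \<Delta> by simp
  qed
  have ne: "cis a \<noteq> cis c" "cis b \<noteq> cis d" using sgn(1,2,5,6) by (metis less_asym)+
  have "path_image (T \<circ> f) \<inter> path_image (T \<circ> g) \<noteq> {}"
  proof (rule fashoda_in_compact[where K = "T ` cball 0 1"])
    show "path (T \<circ> f)" "path (T \<circ> g)" using f g contT by (auto intro: path_continuous_image)
    show "bounded (T ` cball 0 1)"
      by (intro compact_imp_bounded compact_continuous_image contT compact_cball)
    show "path_image (T \<circ> f) \<subseteq> T ` cball 0 1" "path_image (T \<circ> g) \<subseteq> T ` cball 0 1"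
      using f(2) g(2) by (auto simp: path_image_compose)
    show "pathstart (T \<circ> f) $ 1 \<le> p $ 1 \<and> p $ 1 \<le> pathfinish (T \<circ> f) $ 1"
      if "p \<in> T ` cball 0 1" "p $ 2 = 0" for p
    proof -
      obtain z where z: "p = T z" "norm z \<le> 1" using \<open>p \<in> _\<close> by auto
      define t where "t = (X z - X (cis a)) / \<Delta>"
      have Xz: "X z = X (cis a) + t * \<Delta>" using \<Delta> by (simp add: t_def)
      have "\<Delta> *\<^sub>R (z - cis a) = \<Delta> *\<^sub>R (t *\<^sub>R (cis c - cis a))"
        using rep[of z "cis a"] that z sgn T \<Delta> by (simp add: t_def)
      then have "z - cis a = t *\<^sub>R (cis c - cis a)" using \<Delta> by (metis scaleR_cancel_left less_irrefl)
      then have "z = cis a + t *\<^sub>R (cis c - cis a)" by (metis add_diff_cancel_left' diff_add_cancel add.commute)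
      then have "0 \<le> t \<and> t \<le> 1" by (intro chord_in_disc[OF _ _ ne(1) _ z(2)]) auto
      then have "0 \<le> t * \<Delta>" "t * \<Delta> \<le> \<Delta>" using \<Delta> by auto
      then show ?thesis using Xz z f \<Delta>_def by (simp add: T pathstart_compose pathfinish_compose)
    qed
    show "pathstart (T \<circ> g) $ 2 \<le> p $ 2 \<and> p $ 2 \<le> pathfinish (T \<circ> g) $ 2"
      if "p \<in> T ` cball 0 1" "p $ 1 = 0" for p
    proof -
      obtain z where z: "p = T z" "norm z \<le> 1" using \<open>p \<in> _\<close> by auto
      define t where "t = (Y z - Y (cis b)) / \<Delta>"
      have Yz: "Y z = Y (cis b) + t * \<Delta>" using \<Delta> by (simp add: t_def)
      have "\<Delta> *\<^sub>R (z - cis b) = \<Delta> *\<^sub>R (t *\<^sub>R (cis d - cis b))"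
        using rep[of z "cis b"] that z sgn T \<Delta> by (simp add: t_def)
      then have "z - cis b = t *\<^sub>R (cis d - cis b)" using \<Delta> by (metis scaleR_cancel_left less_irrefl)
      then have "z = cis b + t *\<^sub>R (cis d - cis b)" by (metis add_diff_cancel_left' diff_add_cancel add.commute)
      then have "0 \<le> t \<and> t \<le> 1" by (intro chord_in_disc[OF _ _ ne(2) _ z(2)]) auto
      then have "0 \<le> t * \<Delta>" "t * \<Delta> \<le> \<Delta>" using \<Delta> by auto
      then show ?thesis using Yz z g \<Delta>' by (simp add: T pathstart_compose pathfinish_compose)
    qed
  qed (use sgn f g in \<open>auto simp: T pathstart_compose pathfinish_compose\<close>)
  then show ?thesis using inj by (auto simp: path_image_compose dest: injD)
qed

section \<open>From the strip to the disc\<close>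

lemma circle_cyclic_orderI:
  assumes "sorted_wrt (<) \<theta>s" "\<And>x y. x \<in> set \<theta>s \<Longrightarrow> y \<in> set \<theta>s \<Longrightarrow> x < y + 2 * pi"
  shows "circle_cyclic_order (map cis \<theta>s)"
  unfolding circle_cyclic_order_def
proof (intro exI[of _ "\<lambda>i. \<theta>s ! i"] conjI allI impI)
  show "strict_mono_on {..<length (map cis \<theta>s)} ((!) \<theta>s)"
    using assms(1) by (auto simp: strict_mono_on_def sorted_wrt_iff_nth_less)
  fix i assume i: "i < length (map cis \<theta>s)"
  then have "0 < length \<theta>s" by auto
  then show "\<theta>s ! i < \<theta>s ! 0 + 2 * pi" using i by (auto intro!: assms(2))
qed simp

lemma circle_cyclic_order_four:
  assumes "circle_cyclic_order zs" "i < j" "j < k" "k < l" "l < length zs"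
  obtains a b c d where "zs ! i = cis a" "zs ! j = cis b" "zs ! k = cis c" "zs ! l = cis d"
    "a < b" "b < c" "c < d" "d < a + 2 * pi"
proof -
  obtain \<theta> where \<theta>: "\<And>i. i < length zs \<Longrightarrow> zs ! i = cis (\<theta> i)"
    "strict_mono_on {..<length zs} \<theta>" "\<And>i. i < length zs \<Longrightarrow> \<theta> i < \<theta> 0 + 2 * pi"
    using assms(1) unfolding circle_cyclic_order_def by blast
  have mono: "\<theta> x < \<theta> y" if "x < y" "y < length zs" for x y
    using strict_mono_onD[OF \<theta>(2), of x y] that by simp
  have "\<theta> 0 \<le> \<theta> i" using mono[of 0 i] assms by (cases "i = 0") auto
  then have "\<theta> l < \<theta> i + 2 * pi" using \<theta>(3)[of l] assms by linarith
  then show ?thesis using that[of "\<theta> i" "\<theta> j" "\<theta> k" "\<theta> l"] \<theta>(1) mono assms by simp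
qed

text \<open>Each vertical line of the strip is stretched onto a chord, so the bottom and the top of the strip
  become the lower and the upper half of the unit circle.\<close>

definition strip_to_disc :: "complex \<Rightarrow> complex" where
  "strip_to_disc z = Complex (Re z) ((2 * Im z - 1) * sqrt (1 - (Re z)\<^sup>2))"

lemma strip_Re_square: "z \<in> strip \<Longrightarrow> (Re z)\<^sup>2 < 1"
  by (auto simp: strip_def abs_square_less_1 abs_less_iff)

lemma continuous_on_strip_to_disc: "continuous_on S strip_to_disc"
  unfolding strip_to_disc_def[abs_def] Complex_eq by (intro continuous_intros)

lemma inj_on_strip_to_disc: "inj_on strip_to_disc strip"
proof (rule inj_onI)
  fix z w assume zw: "z \<in> strip" "w \<in> strip" "strip_to_disc z = strip_to_disc w"
  have "(Re w)\<^sup>2 < 1" using zw(2) by (rule strip_Re_square)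
  then have "sqrt (1 - (Re w)\<^sup>2) \<noteq> 0" by simp
  moreover have "Re z = Re w"
    "(2 * Im z - 1) * sqrt (1 - (Re w)\<^sup>2) = (2 * Im w - 1) * sqrt (1 - (Re w)\<^sup>2)"
    using zw(3) by (auto simp: strip_to_disc_def)
  ultimately show "z = w" by (simp add: complex_eq_iff)
qed

lemma strip_to_disc_in_disc: "strip_to_disc ` strip \<subseteq> cball 0 1"
proof clarify
  fix z assume z: "z \<in> strip"
  have x: "(Re z)\<^sup>2 < 1" using z by (rule strip_Re_square)
  have "\<bar>2 * Im z - 1\<bar> \<le> 1" using z by (auto simp: strip_def)
  then have "(2 * Im z - 1)\<^sup>2 \<le> 1" by (simp add: abs_square_le_1)
  then have "(2 * Im z - 1)\<^sup>2 * (1 - (Re z)\<^sup>2) \<le> 1 * (1 - (Re z)\<^sup>2)"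
    using x by (intro mult_right_mono) auto
  moreover have "(cmod (strip_to_disc z))\<^sup>2 = (Re z)\<^sup>2 + (2 * Im z - 1)\<^sup>2 * (1 - (Re z)\<^sup>2)"
    using x by (simp add: strip_to_disc_def cmod_power2 power_mult_distrib)
  ultimately have "(cmod (strip_to_disc z))\<^sup>2 \<le> 1" by argo
  then show "strip_to_disc z \<in> cball 0 1" by (simp add: abs_square_le_1)
qed

text \<open>The full turn is added so that the angles of the bottom range from \<open>pi\<close> to
  \<open>2 * pi\<close> and continue with those of the top, from \<open>2 * pi\<close> to
  \<open>3 * pi\<close>.\<close>

lemma strip_to_disc_bottom:
  assumes "\<bar>Re z\<bar> \<le> 1" "Im z = 0"
  shows "strip_to_disc z = cis (2 * pi - arccos (Re z))"
  using assms by (simp add: strip_to_disc_def complex_eq_iff sin_arccos_abs cos_diff sin_diff)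

lemma strip_to_disc_top:
  assumes "\<bar>Re z\<bar> \<le> 1" "Im z = 1"
  shows "strip_to_disc z = cis (2 * pi + arccos (Re z))"
  using assms by (simp add: strip_to_disc_def complex_eq_iff sin_arccos_abs cos_add sin_add)

text \<open>Anticlockwise, the bottom is traversed from left to right and the top from right to
  left, hence \<open>rev ts\<close>. Real parts strictly between -1 and 1 keep all angles within
  less than one turn.\<close>

lemma strip_drawing_cyclic_order:
  assumes "strip_drawing E ss ts pt cv"
  shows "circle_cyclic_order (map (strip_to_disc \<circ> pt) (ss @ rev ts))"
proof -
  have pd: "plane_drawing_in strip (network_graph E ss ts) pt cv"
    and ss: "sorted_wrt (\<lambda>x y. Re (pt x) < Re (pt y)) ss"
    and ts: "sorted_wrt (\<lambda>x y. Re (pt x) < Re (pt y)) ts"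
    and im: "\<And>s. s \<in> set ss \<Longrightarrow> Im (pt s) = 0" "\<And>t. t \<in> set ts \<Longrightarrow> Im (pt t) = 1"
    using assms unfolding strip_drawing_def by blast+
  have re: "- 1 < Re (pt w) \<and> Re (pt w) < 1" if "w \<in> set ss \<union> set ts" for w
    using plane_drawing_inD(2)[OF pd, of w] that by (auto simp: strip_def)
  define \<alpha> where "\<alpha> w = arccos (Re (pt w))" for w
  have bd: "0 < \<alpha> w \<and> \<alpha> w < pi" if "w \<in> set ss \<union> set ts" for w
    using arccos_lt_bounded[of "Re (pt w)"] re[OF that] by (simp add: \<alpha>_def)
  have mono: "\<alpha> y < \<alpha> x" if "Re (pt x) < Re (pt y)" "x \<in> set ss \<union> set ts" "y \<in> set ss \<union> set ts" for x y
    unfolding \<alpha>_def using that re by (intro arccos_less_arccos) (auto simp: less_imp_le)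
  let ?\<theta> = "map (\<lambda>s. 2 * pi - \<alpha> s) ss @ map (\<lambda>t. 2 * pi + \<alpha> t) (rev ts)"
  have "circle_cyclic_order (map cis ?\<theta>)"
  proof (rule circle_cyclic_orderI)
    have "sorted_wrt (\<lambda>x y. 2 * pi - \<alpha> x < 2 * pi - \<alpha> y) ss"
      by (rule sorted_wrt_mono_rel[OF _ ss]) (simp add: mono)
    moreover have "sorted_wrt (\<lambda>y x. 2 * pi + \<alpha> x < 2 * pi + \<alpha> y) ts"
      by (rule sorted_wrt_mono_rel[OF _ ts]) (simp add: mono)
    moreover have "2 * pi - \<alpha> x < 2 * pi + \<alpha> y" if "x \<in> set ss" "y \<in> set ts" for x y
      using bd[of x] bd[of y] that by simp
    ultimately show "sorted_wrt (<) ?\<theta>"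
      by (simp add: sorted_wrt_append sorted_wrt_map sorted_wrt_rev)
    show "x < y + 2 * pi" if "x \<in> set ?\<theta>" "y \<in> set ?\<theta>" for x y
    proof -
      have "pi < z \<and> z < 3 * pi" if "z \<in> set ?\<theta>" for z using that bd by fastforce
      from this[OF that(1)] this[OF that(2)] show ?thesis by linarith
    qed
  qed
  also have "map cis ?\<theta> = map (strip_to_disc \<circ> pt) (ss @ rev ts)"
    using re im by (auto simp: \<alpha>_def strip_to_disc_bottom strip_to_disc_top abs_le_iff less_imp_le)
  finally show ?thesis .
qed

section \<open>Acyclic digraphs\<close>

lemma card_ge_2D:
  assumes "2 \<le> card A"
  obtains x y where "x \<in> A" "y \<in> A" "x \<noteq> y"
proof -
  obtain x where "x \<in> A" using assms by fastforce
  moreover have "A \<noteq> {x}" using assms by auto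
  ultimately show ?thesis using that by blast
qed

section \<open>Digraphs and their adjacency relations\<close>

context digraph
begin

lemma arc_in_arcs_ends: "e \<in> arcs G \<Longrightarrow> (tail G e, head G e) \<in> arcs_ends G"
  unfolding arcs_ends_def arc_to_ends_def by blast

lemma acyclic_arcs_ends:
  assumes "acyclic_digraph G"
  shows "acyclic (arcs_ends G)"
proof (rule acyclicI, intro allI notI)
  fix v assume "(v, v) \<in> (arcs_ends G)\<^sup>+"
  then obtain p where "awalk v p v" "p \<noteq> []" by (auto simp: reachable1_awalk)
  then have "closed_w p" by (auto simp: closed_w_def)
  then show False using closed_w_imp_cycle assms by (auto simp: acyclic_digraph_def)
qed

lemma dwalk_arcs_ends:
  assumes "dwalk (arcs_ends G) x P y" and "x \<in> verts G"
  shows "\<exists>p. awalk x p y \<and> set (awalk_verts x p) = P"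
  using assms
proof (induction rule: dwalk.induct)
  case (dwalk_refl x)
  then show ?case by (intro exI[of _ "[]"]) (auto simp: awalk_Nil_iff)
next
  case (dwalk_step x y P z)
  then obtain e where e: "e \<in> arcs G" "x = tail G e" "y = head G e"
    by (auto simp: arcs_ends_def arc_to_ends_def)
  then obtain p where p: "awalk y p z" "set (awalk_verts y p) = P" using dwalk_step by auto
  then show ?case using e by (intro exI[of _ "e # p"]) (auto simp: awalk_Cons_iff)
qed

text \<open>A repeated vertex would cut out a closed walk and hence a cycle. So the walks obtained
  from \<open>dwalk\<close> are dipaths.\<close>

lemma awalk_is_apath:
  assumes "acyclic_digraph G" "awalk x p y"
  shows "apath x p y"
proof (rule ccontr)
  assume "\<not> apath x p y"
  then have "\<not> distinct (awalk_verts x p)" using assms(2) by (simp add: apath_def)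
  then show False
    using awalk_not_distinct_decomp[OF assms(2)] closed_w_imp_cycle assms(1)
    by (auto simp: acyclic_digraph_def closed_w_def)
qed

lemma network_arcs_ends:
  assumes "acyclic_digraph G" "distinct ss" "set ss = sources G" "distinct ts" "set ts = sinks G"
    "sources G \<inter> sinks G = {}"
    and deg: "\<And>v. v \<in> verts G \<Longrightarrow> v \<notin> sources G \<union> sinks G \<Longrightarrow> in_degree G v \<ge> 2 \<and> out_degree G v \<ge> 2"
  shows "network (arcs_ends G) ss ts"
  unfolding network_def
proof (intro conjI ballI)
  show "finite (arcs_ends G)" by (simp add: arcs_ends_def)
  show "acyclic (arcs_ends G)" by (rule acyclic_arcs_ends) fact
  show "set ss \<inter> Range (arcs_ends G) = {}" 
    using assms(3) by (auto simp: sources_def in_degree_def arcs_ends_def arc_to_ends_def in_arcs_def)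
  show "set ts \<inter> Domain (arcs_ends G) = {}"
    using assms(5) by (auto simp: sinks_def out_degree_def arcs_ends_def arc_to_ends_def out_arcs_def)
next
  fix v assume "v \<in> Field (arcs_ends G) - set ss - set ts"
  then have v: "v \<in> verts G" "v \<notin> sources G \<union> sinks G"
    using assms(3,5) by (auto simp: Field_def arcs_ends_def arc_to_ends_def)
  obtain e f where ef: "e \<in> in_arcs G v" "f \<in> in_arcs G v" "e \<noteq> f"
    using card_ge_2D[of "in_arcs G v"] deg[OF v] by (auto simp: in_degree_def)
  \<comment> \<open>Without parallel arcs, two arcs into the same vertex have different tails; this
    turns degrees into numbers of neighbours.\<close>
  then have "tail G e \<noteq> tail G f" using no_multi_arcs[of e f] by (auto simp: arc_to_ends_def)
  then show "\<exists>x y. x \<noteq> y \<and> (x, v) \<in> arcs_ends G \<and> (y, v) \<in> arcs_ends G"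
    using ef arc_in_arcs_ends[of e] arc_in_arcs_ends[of f] by auto
  obtain e f where ef: "e \<in> out_arcs G v" "f \<in> out_arcs G v" "e \<noteq> f"
    using card_ge_2D[of "out_arcs G v"] deg[OF v] by (auto simp: out_degree_def)
  then have "head G e \<noteq> head G f" using no_multi_arcs[of e f] by (auto simp: arc_to_ends_def)
  then show "\<exists>x y. x \<noteq> y \<and> (v, x) \<in> arcs_ends G \<and> (v, y) \<in> arcs_ends G"
    using ef arc_in_arcs_ends[of e] arc_in_arcs_ends[of f] by auto
qed (use assms in auto)

lemma crossed_is_cross:
  assumes "acyclic_digraph G" "set ss \<subseteq> verts G" "crossed (arcs_ends G) ss ts"
  shows "\<exists>p p'. is_cross G ss ts p p'"
proof -
  obtain s s' t t' P P' where *: "before ss s s'" "before ts t' t" "dwalk (arcs_ends G) s P t"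
      "dwalk (arcs_ends G) s' P' t'" "P \<inter> P' = {}"
    using assms(3) unfolding crossed_def by blast
  obtain i i' where i: "i < i'" "i' < length ss" "ss ! i = s" "ss ! i' = s'"
    using *(1) by (auto simp: before_iff_nth)
  obtain j j' where j: "j' < j" "j < length ts" "ts ! j = t" "ts ! j' = t'"
    using *(2) by (auto simp: before_iff_nth)
  have "s \<in> verts G" "s' \<in> verts G" using before_in_set[OF *(1)] assms(2) by auto
  then obtain p p' where p: "awalk s p t" "set (awalk_verts s p) = P"
      "awalk s' p' t'" "set (awalk_verts s' p') = P'"
    using dwalk_arcs_ends *(3,4) by metis
  have "is_cross G ss ts p p'"
    unfolding is_cross_def
    using i j p *(5) awalk_is_apath[OF assms(1)]
    by (intro exI[of _ i] exI[of _ i'] exI[of _ j] exI[of _ j']) (auto simp: vertex_disjoint_def)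
  then show ?thesis by blast
qed

text \<open>As there are no parallel arcs, the arcs of \<open>G\<close> correspond one to one to the
  pairs in \<open>arcs_ends G\<close>, and each takes over the curve of its pair.\<close>

lemma network_drawing:
  assumes "strip_drawing (arcs_ends G) ss ts pt cv"
    and V: "verts G = Field (arcs_ends G) \<union> set ss \<union> set ts"
  shows "drawable_in_disc G (ss @ rev ts)"
proof -
  have pd: "plane_drawing_in strip (network_graph (arcs_ends G) ss ts) pt cv"
    using assms(1) by (simp add: strip_drawing_def)
  have "plane_drawing_in (cball 0 1) (network_graph (arcs_ends G) ss ts)
      (strip_to_disc \<circ> pt) (\<lambda>e. strip_to_disc \<circ> cv e)"
    by (rule plane_drawing_in_image[OF pd continuous_on_strip_to_disc inj_on_strip_to_disc
          strip_to_disc_in_disc]) (auto simp: Field_def)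
  note d = plane_drawing_inD[OF this, unfolded pre_digraph.simps, folded V]
  define cv' where "cv' e = strip_to_disc \<circ> cv (arc_to_ends G e)" for e
  have ends: "arc_to_ends G e \<in> arcs_ends G" if "e \<in> arcs G" for e using that by (simp add: arcs_ends_def)
  have "plane_drawing_in (cball 0 1) G (strip_to_disc \<circ> pt) cv'"
    unfolding plane_drawing_in_def
  proof (intro conjI ballI impI)
    show "inj_on (strip_to_disc \<circ> pt) (verts G)" by (rule d(1))
    show "(strip_to_disc \<circ> pt) ` verts G \<subseteq> cball 0 1" using d(2) by blast
  next
    fix e assume e: "e \<in> arcs G"
    show "Path_Connected.arc (cv' e)" "path_image (cv' e) \<subseteq> cball 0 1"
      "pathstart (cv' e) = (strip_to_disc \<circ> pt) (tail G e)"
      "pathfinish (cv' e) = (strip_to_disc \<circ> pt) (head G e)"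
      using d(3)[OF ends[OF e]] by (simp_all add: cv'_def arc_to_ends_def)
    fix v assume "v \<in> verts G" "(strip_to_disc \<circ> pt) v \<in> path_image (cv' e)"
    then show "v \<in> {tail G e, head G e}"
      using d(4)[OF ends[OF e]] by (simp add: cv'_def arc_to_ends_def)
  next
    fix e f assume ef: "e \<in> arcs G" "f \<in> arcs G" "e \<noteq> f"
    then have "arc_to_ends G e \<noteq> arc_to_ends G f" using no_multi_arcs by blast
    from d(5)[OF ends ends this] ef
    show "path_image (cv' e) \<inter> path_image (cv' f)
        \<subseteq> (strip_to_disc \<circ> pt) ` ({tail G e, head G e} \<inter> {tail G f, head G f})"
      by (simp add: cv'_def arc_to_ends_def)
  qed
  moreover have "circle_cyclic_order (map (strip_to_disc \<circ> pt) (ss @ rev ts))"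
    by (rule strip_drawing_cyclic_order) fact
  ultimately show ?thesis unfolding drawable_in_disc_def by blast
qed

text \<open>The curves of the arcs are joined. The points of the vertices appear in the bound for
  the sake of the empty walk, whose path is constant.\<close>

lemma awalk_drawing:
  assumes d: "plane_drawing_in D G pt cv" and "awalk u p w"
  shows "\<exists>g. path g \<and> pathstart g = pt u \<and> pathfinish g = pt w \<and>
    path_image g \<subseteq> pt ` set (awalk_verts u p) \<union> (\<Union>e \<in> set p. path_image (cv e))"
  using assms(2)
proof (induction p arbitrary: u)
  case Nil
  then have "u = w" by (simp add: awalk_Nil_iff)
  then show ?case
    by (intro exI[of _ "\<lambda>_. pt u"]) (simp add: path_def pathstart_def pathfinish_def path_image_def)
next
  case (Cons e p)
  then have e: "e \<in> arcs G" "u = tail G e" "awalk (head G e) p w" by (auto simp: awalk_Cons_iff)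
  obtain g where g: "path g" "pathstart g = pt (head G e)" "pathfinish g = pt w"
    "path_image g \<subseteq> pt ` set (awalk_verts (head G e) p) \<union> (\<Union>e \<in> set p. path_image (cv e))"
    using Cons.IH[OF e(3)] by blast
  note c = plane_drawing_inD(3)[OF d e(1)]
  have "path_image (cv e +++ g) = path_image (cv e) \<union> path_image g"
    using c g by (intro path_image_join) auto
  then show ?case using c g e
    by (intro exI[of _ "cv e +++ g"]) (auto simp: arc_imp_path)
qed

text \<open>A point shared by two vertices or curves of a drawing comes from a common vertex or end,
  and both ends of an arc of a walk are vertices of that walk.\<close>

lemma disjoint_awalks_drawing:
  assumes d: "plane_drawing_in D G pt cv" and w: "awalk u p w" "awalk u' p' w'"
    and dj: "set (awalk_verts u p) \<inter> set (awalk_verts u' p') = {}"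
  shows "(pt ` set (awalk_verts u p) \<union> (\<Union>e \<in> set p. path_image (cv e))) \<inter>
    (pt ` set (awalk_verts u' p') \<union> (\<Union>e \<in> set p'. path_image (cv e))) = {}" (is "?A \<inter> ?A' = {}")
proof -
  have arcs: "set p \<subseteq> arcs G" "set p' \<subseteq> arcs G" using w by blast+
  have verts: "set (awalk_verts u p) \<subseteq> verts G" "set (awalk_verts u' p') \<subseteq> verts G" using w by blast+
  have ends: "tail G e \<in> set (awalk_verts x q) \<and> head G e \<in> set (awalk_verts x q)"
    if "awalk x q y" "e \<in> set q" for x q y e
    using that awalk_verts_arc1 awalk_verts_arc2 by (metis awalkE)
  note dp = plane_drawing_inD[OF d]
  show ?thesis
  proof (rule ccontr)
    assume "?A \<inter> ?A' \<noteq> {}"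
    then obtain z where z: "z \<in> ?A" "z \<in> ?A'" by blast
    then consider (vv) x x' where "x \<in> set (awalk_verts u p)" "x' \<in> set (awalk_verts u' p')" "z = pt x" "z = pt x'"
      | (ve) x e where "x \<in> set (awalk_verts u p)" "e \<in> set p'" "z = pt x" "z \<in> path_image (cv e)"
      | (ev) x e where "x \<in> set (awalk_verts u' p')" "e \<in> set p" "z = pt x" "z \<in> path_image (cv e)"
      | (ee) e f where "e \<in> set p" "f \<in> set p'" "z \<in> path_image (cv e)" "z \<in> path_image (cv f)"
      by blast
    then show False
    proof cases
      case vv
      then have "x = x'" using inj_onD[OF dp(1)] verts by blast
      then show False using vv dj by blast
    next
      case ve
      then have "x \<in> {tail G e, head G e}" using dp(4)[of e x] arcs verts by blast
      then show False using ends[OF w(2) ve(2)] ve(1) dj by blast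
    next
      case ev
      then have "x \<in> {tail G e, head G e}" using dp(4)[of e x] arcs verts by blast
      then show False using ends[OF w(1) ev(2)] ev(1) dj by blast
    next
      case ee
      have ef: "tail G e \<in> set (awalk_verts u p)" "head G e \<in> set (awalk_verts u p)"
        "tail G f \<in> set (awalk_verts u' p')" "head G f \<in> set (awalk_verts u' p')"
        using ends[OF w(1) ee(1)] ends[OF w(2) ee(2)] by blast+
      then have "e \<noteq> f" using dj by blast
      then have "{tail G e, head G e} \<inter> {tail G f, head G f} \<noteq> {}"
        using dp(5)[of e f] ee arcs by blast
      then obtain x where "x \<in> {tail G e, head G e}" "x \<in> {tail G f, head G f}" by blast
      then have "x \<in> set (awalk_verts u p)" "x \<in> set (awalk_verts u' p')" using ef by auto
      then show False using dj by blast
    qed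
  qed
qed

text \<open>The ends of the two dipaths of a cross interleave on the circle, so the drawn dipaths
  meet, although disjoint walks are drawn disjointly.\<close>

lemma not_cross_and_drawable:
  assumes "is_cross G ss ts p p'" "drawable_in_disc G (ss @ rev ts)"
  shows False
proof -
  obtain pt cv where d: "plane_drawing_in (cball 0 1) G pt cv"
    and ord: "circle_cyclic_order (map pt (ss @ rev ts))"
    using assms(2) unfolding drawable_in_disc_def by blast
  have no: False
    if i: "i < i'" "i' < length ss" and j: "j' < j" "j < length ts"
      and w: "awalk (ss ! i) q (ts ! j)" "awalk (ss ! i') q' (ts ! j')"
      and dj: "set (awalk_verts (ss ! i) q) \<inter> set (awalk_verts (ss ! i') q') = {}" for i i' j j' q q'
  proof -
    let ?n = "length ss" and ?m = "length ts"
    let ?zs = "map pt (ss @ rev ts)"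
    \<comment> \<open>Positions of \<open>ts ! j\<close> and \<open>ts ! j'\<close> in the list; the
      reversal turns \<open>j' < j\<close> into \<open>?k < ?l\<close>.\<close>
    let ?k = "?n + (?m - Suc j)" and ?l = "?n + (?m - Suc j')"
    have idx: "i < i'" "i' < ?k" "?k < ?l" "?l < length ?zs" using i j by auto
    have nth: "?zs ! i = pt (ss ! i)" "?zs ! i' = pt (ss ! i')" "?zs ! ?k = pt (ts ! j)" "?zs ! ?l = pt (ts ! j')"
      using i j by (auto simp: nth_append rev_nth)
    obtain a b c e where abc: "?zs ! i = cis a" "?zs ! i' = cis b" "?zs ! ?k = cis c" "?zs ! ?l = cis e"
      "a < b" "b < c" "c < e" "e < a + 2 * pi"
      using circle_cyclic_order_four[OF ord idx] by blast
    obtain f where f: "path f" "pathstart f = pt (ss ! i)" "pathfinish f = pt (ts ! j)"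
      "path_image f \<subseteq> pt ` set (awalk_verts (ss ! i) q) \<union> (\<Union>e \<in> set q. path_image (cv e))" (is "_ \<subseteq> ?F")
      using awalk_drawing[OF d w(1)] by blast
    obtain g where g: "path g" "pathstart g = pt (ss ! i')" "pathfinish g = pt (ts ! j')"
      "path_image g \<subseteq> pt ` set (awalk_verts (ss ! i') q') \<union> (\<Union>e \<in> set q'. path_image (cv e))" (is "_ \<subseteq> ?G")
      using awalk_drawing[OF d w(2)] by blast
    have sub: "?F \<subseteq> cball 0 1" "?G \<subseteq> cball 0 1"
      using w plane_drawing_inD(2,3)[OF d] by blast+
    have "path_image f \<inter> path_image g \<noteq> {}"
    proof (rule interleaved_paths_meet[of f a c g b e])
      show "path_image f \<subseteq> cball 0 1" "path_image g \<subseteq> cball 0 1"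
        using f(4) g(4) sub by (meson order_trans)+
      show "pathstart f = cis a" "pathfinish f = cis c" "pathstart g = cis b" "pathfinish g = cis e"
        using f g abc(1-4) nth by metis+
    qed (use f(1) g(1) abc(5-8) in auto)
    moreover have "path_image f \<inter> path_image g \<subseteq> {}"
      using Int_mono[OF f(4) g(4)] unfolding disjoint_awalks_drawing[OF d w dj] .
    ultimately show False by blast
  qed
  obtain i i' j j' where *: "i < length ss" "i' < length ss" "j < length ts" "j' < length ts"
      "awalk (ss ! i) p (ts ! j)" "awalk (ss ! i') p' (ts ! j')"
      "set (awalk_verts (ss ! i) p) \<inter> set (awalk_verts (ss ! i') p') = {}"
      "i < i' \<and> j > j' \<or> i > i' \<and> j < j'"
    using assms(1) unfolding is_cross_def vertex_disjoint_def apath_def by auto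
  from *(8) show False
  proof
    assume "i < i' \<and> j > j'"
    then show False using no[of i i' j' j p p'] * by blast
  next
    assume "i > i' \<and> j < j'"
    then show False using no[of i' i j j' p' p] * by (simp add: Int_commute)
  qed
qed

end

theorem theorem1p2:
  fixes G :: "('a, 'b) pre_digraph" and ss ts :: "'a list"
  assumes "digraph G"
    and "acyclic_digraph G"
    and "distinct ss" and "set ss = sources G"
    and "distinct ts" and "set ts = sinks G"
    and "sources G \<inter> sinks G = {}"
    and "\<And>v. v \<in> verts G \<Longrightarrow> v \<notin> sources G \<union> sinks G \<Longrightarrow>
           in_degree G v \<ge> 2 \<and> out_degree G v \<ge> 2"
  shows "((\<exists>p p'. is_cross G ss ts p p') \<or> drawable_in_disc G (ss @ rev ts)) \<and>
         \<not> ((\<exists>p p'. is_cross G ss ts p p') \<and> drawable_in_disc G (ss @ rev ts))"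
proof (intro conjI)
  interpret digraph G by fact
  have net: "network (arcs_ends G) ss ts" by (rule network_arcs_ends) fact+
  have V: "verts G = Field (arcs_ends G) \<union> set ss \<union> set ts"
  proof
    show "verts G \<subseteq> Field (arcs_ends G) \<union> set ss \<union> set ts"
    proof
      fix v assume v: "v \<in> verts G"
      show "v \<in> Field (arcs_ends G) \<union> set ss \<union> set ts"
      proof (cases "v \<in> sources G")
        case False
        then have "in_arcs G v \<noteq> {}" using v by (auto simp: sources_def in_degree_def)
        then show ?thesis by (force simp: Field_def arcs_ends_def arc_to_ends_def in_arcs_def)
      qed (use assms in auto)
    qed
    show "Field (arcs_ends G) \<union> set ss \<union> set ts \<subseteq> verts G"
      using assms by (auto simp: Field_def arcs_ends_def arc_to_ends_def sources_def sinks_def)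
  qed
  show "(\<exists>p p'. is_cross G ss ts p p') \<or> drawable_in_disc G (ss @ rev ts)"
  proof (cases "crossed (arcs_ends G) ss ts")
    case True
    then show ?thesis using crossed_is_cross assms(2) V by blast
  next
    case False
    then show ?thesis using strip_drawing_exists[OF net] network_drawing V by blast
  qed
  show "\<not> ((\<exists>p p'. is_cross G ss ts p p') \<and> drawable_in_disc G (ss @ rev ts))"
    using not_cross_and_drawable by blast
qed

end
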